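(* Let $\mu\ge0$ and let $H(t)$, $t\in\mathbb R$, be a $1$-periodic family of symmetric operators on $\mathcal H$ such that for every $r\ge0$ the operators $H(t):\mathcal H^{r+\mu}\to\mathcal H^r$ are bounded and depend continuously on $t\in[0,1]$ in the operator norm of $\mathcal L(\mathcal H^{r+\mu},\mathcal H^r)$. Let $\ell\ge0$ be an integer, $r\ge0$, and $u\in\mathcal H^{r+(\ell+1)\mu}$. Then $$H^{[\ell]}_{\mathrm{FM},N}P_Nu\longrightarrow H^{[\ell]}_{\mathrm{FM}}u\qquad\text{in }\mathcal H^r\text{ as }N\to\infty .$$
   Context: $\mathcal H$ is a complex separable Hilbert space and $H_0$ a positive self-adjoint operator on $\mathcal H$ with compact resolvent (spectrum contained in $[0,\infty)$). For $N>0$, $P_N=\mathbf 1_{[0,N]}(H_0)$, $\mathcal H_N=P_N\mathcal H$ (finite-dimensional), $H_N(t)=P_NH(t)P_N$ on $\mathcal H_N$. For $r\ge0$, $\mathcal H^r=D((1+H_0)^r)$ with norm $\|u\|_r=\|(1+H_0)^ru\|$. Floquet--Magnus coefficients: for a family $A(\tau)$, $\tau\in[0,1]$, put $$D_n[A]=\int_{1\ge\tau_1\ge\dots\ge\tau_n\ge0}A(\tau_1)A(\tau_2)\cdots A(\tau_n)\,d\tau_n\cdots d\tau_1,$$ $$\mathrm{FM}^{[\ell]}[A]=\mathrm i\,(-\mathrm i)^{\ell+1}\sum_{k=1}^{\ell+1}\frac{(-1)^{k-1}}{k}\sum_{\substack{n_1+\dots+n_k=\ell+1\\ n_i\ge1}}D_{n_1}[A]\cdots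 D_{n_k}[A].$$ This is the coefficient in the Magnus expansion $\log U^{(T)}(T,0)\sim-\mathrm iT\sum_{\ell\ge0}T^\ell\,\mathrm{FM}^{[\ell]}[A]$ for $\mathrm i\partial_tU^{(T)}=A(t/T)U^{(T)}$; it is equal to a universal linear combination of iterated integrals of nested commutators of $\ell+1$ factors $A(\tau_i)$. For example $\mathrm{FM}^{[0]}[A]=\int_0^1A(\tau)\,d\tau$ and $\mathrm{FM}^{[1]}[A]=-\frac{\mathrm i}{2}\int_0^1\int_0^{\tau_1}[A(\tau_1),A(\tau_2)]\,d\tau_2\,d\tau_1$. Then $H^{[\ell]}_{\mathrm{FM},N}:=\mathrm{FM}^{[\ell]}[H_N]$ is an operator on $\mathcal H_N$, and $H^{[\ell]}_{\mathrm{FM}}:=\mathrm{FM}^{[\ell]}[H]$ is a bounded operator $\mathcal H^{r+(\ell+1)\mu}\to\mathcal H^r$ for every $r\ge0$ (a product of $n$ factors $H(\tau_i)$ maps $\mathcal H^{r+n\mu}$ to $\mathcal H^r$). *)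

theory Defs
  imports "HOL-Analysis.Analysis"
begin

text \<open>
  The real inner product of the underlying real Hilbert space is the real part of the complex
  one, so norm and topology are those of the library class \<open>real_inner\<close>. The complex inner
  product is antilinear in its first argument. Separability is not part of the class.
\<close>

class complex_hilbert = real_inner + complete_space +
  fixes scaleC :: "complex \<Rightarrow> 'a \<Rightarrow> 'a"  (infixr \<open>*\<^sub>C\<close> 75)
    and cinner :: "'a \<Rightarrow> 'a \<Rightarrow> complex"
  assumes scaleC_add_right: "a *\<^sub>C (x + y) = a *\<^sub>C x + a *\<^sub>C y"
    and scaleC_add_left: "(a + b) *\<^sub>C x = a *\<^sub>C x + b *\<^sub>C x"
    and scaleC_scaleC: "a *\<^sub>C b *\<^sub>C x = (a * b) *\<^sub>C x"
    and scaleC_one: "1 *\<^sub>C x = x"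
    and scaleR_scaleC: "r *\<^sub>R x = complex_of_real r *\<^sub>C x"
    and cinner_commute: "cinner x y = cnj (cinner y x)"
    and cinner_add_left: "cinner (x + y) z = cinner x z + cinner y z"
    and cinner_scaleC_left: "cinner (a *\<^sub>C x) y = cnj a * cinner x y"
    and inner_cinner: "inner x y = Re (cinner x y)"
begin

subclass banach ..

end

text \<open>
  An operator is given by its domain \<open>D\<close> and a function \<open>T\<close> whose values outside
  \<open>D\<close> carry no meaning.
\<close>

definition linear_operator :: "'a::complex_hilbert set \<Rightarrow> ('a \<Rightarrow> 'a) \<Rightarrow> bool" where
  "linear_operator D T \<longleftrightarrow>
     0 \<in> D \<and>
     (\<forall>u\<in>D. \<forall>v\<in>D. u + v \<in> D \<and> T (u + v) = T u + T v) \<and>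
     (\<forall>c. \<forall>u\<in>D. c *\<^sub>C u \<in> D \<and> T (c *\<^sub>C u) = c *\<^sub>C T u)"

definition densely_defined_operator :: "'a::complex_hilbert set \<Rightarrow> ('a \<Rightarrow> 'a) \<Rightarrow> bool" where
  "densely_defined_operator D T \<longleftrightarrow> linear_operator D T \<and> closure D = UNIV"

definition symmetric_operator :: "'a::complex_hilbert set \<Rightarrow> ('a \<Rightarrow> 'a) \<Rightarrow> bool" where
  "symmetric_operator D T \<longleftrightarrow>
     densely_defined_operator D T \<and> (\<forall>u\<in>D. \<forall>v\<in>D. cinner (T u) v = cinner u (T v))"

definition graph_of :: "'a set \<Rightarrow> ('a \<Rightarrow> 'a) \<Rightarrow> ('a \<times> 'a) set" where
  "graph_of D T = {(v, w). v \<in> D \<and> w = T v}"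

definition adjoint_graph :: "'a::complex_hilbert set \<Rightarrow> ('a \<Rightarrow> 'a) \<Rightarrow> ('a \<times> 'a) set" where
  "adjoint_graph D T = {(v, w). \<forall>u\<in>D. cinner (T u) v = cinner u w}"

definition selfadjoint_operator :: "'a::complex_hilbert set \<Rightarrow> ('a \<Rightarrow> 'a) \<Rightarrow> bool" where
  "selfadjoint_operator D T \<longleftrightarrow>
     densely_defined_operator D T \<and> adjoint_graph D T = graph_of D T"

definition positive_operator :: "'a::complex_hilbert set \<Rightarrow> ('a \<Rightarrow> 'a) \<Rightarrow> bool" where
  "positive_operator D T \<longleftrightarrow> (\<forall>u\<in>D. cinner u (T u) \<in> \<real> \<and> 0 \<le> Re (cinner u (T u)))"

definition resolvent :: "'a::complex_hilbert set \<Rightarrow> ('a \<Rightarrow> 'a) \<Rightarrow> complex \<Rightarrow> 'a \<Rightarrow> 'a" where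
  "resolvent D T z = inv_into D (\<lambda>u. T u - z *\<^sub>C u)"

definition resolvent_set :: "'a::complex_hilbert set \<Rightarrow> ('a \<Rightarrow> 'a) \<Rightarrow> complex set" where
  "resolvent_set D T =
     {z. bij_betw (\<lambda>u. T u - z *\<^sub>C u) D UNIV \<and> bounded_linear (resolvent D T z)}"

text \<open>
  Compactness of the resolvent at one point implies it at every point of the resolvent set,
  by the resolvent identity.
\<close>

definition has_compact_resolvent :: "'a::complex_hilbert set \<Rightarrow> ('a \<Rightarrow> 'a) \<Rightarrow> bool" where
  "has_compact_resolvent D T \<longleftrightarrow>
     (\<exists>z\<in>resolvent_set D T. compact (closure (resolvent D T z ` cball 0 1)))"

text \<open>
  For a self-adjoint operator with compact resolvent the spectral measure is the sum of the
  orthogonal projections onto the eigenspaces, so \<open>f(T) u\<close> is the sum over the eigenvalues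
  \<open>x\<close> of \<open>f x\<close> times the projection of \<open>u\<close> onto the eigenspace of \<open>x\<close>,
  with domain the set of all \<open>u\<close> for which the squared norms are summable.
\<close>

definition eigenspace :: "'a::complex_hilbert set \<Rightarrow> ('a \<Rightarrow> 'a) \<Rightarrow> real \<Rightarrow> 'a set" where
  "eigenspace D T x = {u\<in>D. T u = x *\<^sub>R u}"

definition eigenvalues :: "'a::complex_hilbert set \<Rightarrow> ('a \<Rightarrow> 'a) \<Rightarrow> real set" where
  "eigenvalues D T = {x. \<exists>u\<in>eigenspace D T x. u \<noteq> 0}"

definition orth_proj :: "'a::complex_hilbert set \<Rightarrow> 'a \<Rightarrow> 'a" where
  "orth_proj S u = (THE v. v \<in> S \<and> (\<forall>w\<in>S. cinner w (u - v) = 0))"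

definition fun_calc_dom ::
    "'a::complex_hilbert set \<Rightarrow> ('a \<Rightarrow> 'a) \<Rightarrow> (real \<Rightarrow> real) \<Rightarrow> 'a set" where
  "fun_calc_dom D T f =
     {u. (\<lambda>x. (f x * norm (orth_proj (eigenspace D T x) u))\<^sup>2) summable_on eigenvalues D T}"

definition fun_calc ::
    "'a::complex_hilbert set \<Rightarrow> ('a \<Rightarrow> 'a) \<Rightarrow> (real \<Rightarrow> real) \<Rightarrow> 'a \<Rightarrow> 'a" where
  "fun_calc D T f u =
     (\<Sum>\<^sub>\<infinity>x\<in>eigenvalues D T. f x *\<^sub>R orth_proj (eigenspace D T x) u)"

definition spec_proj :: "'a::complex_hilbert set \<Rightarrow> ('a \<Rightarrow> 'a) \<Rightarrow> real \<Rightarrow> 'a \<Rightarrow> 'a" where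
  "spec_proj D T N = fun_calc D T (indicator {0..N})"

definition scale_space :: "'a::complex_hilbert set \<Rightarrow> ('a \<Rightarrow> 'a) \<Rightarrow> real \<Rightarrow> 'a set" where
  "scale_space D T r = fun_calc_dom D T (\<lambda>x. (1 + x) powr r)"

definition scale_norm :: "'a::complex_hilbert set \<Rightarrow> ('a \<Rightarrow> 'a) \<Rightarrow> real \<Rightarrow> 'a \<Rightarrow> real" where
  "scale_norm D T r u = norm (fun_calc D T (\<lambda>x. (1 + x) powr r) u)"

definition scale_bounded ::
    "'a::complex_hilbert set \<Rightarrow> ('a \<Rightarrow> 'a) \<Rightarrow> real \<Rightarrow> real \<Rightarrow> ('a \<Rightarrow> 'a) \<Rightarrow> bool" where
  "scale_bounded D T s r A \<longleftrightarrow>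
     A ` scale_space D T s \<subseteq> scale_space D T r \<and>
     (\<exists>C. \<forall>u\<in>scale_space D T s. scale_norm D T r (A u) \<le> C * scale_norm D T s u)"

text \<open>
  Operator norm from the space of order \<open>s\<close> to that of order \<open>r\<close>, as in
  \<open>onorm\<close>; meaningful for operators satisfying \<open>scale_bounded\<close>.
\<close>

definition scale_onorm ::
    "'a::complex_hilbert set \<Rightarrow> ('a \<Rightarrow> 'a) \<Rightarrow> real \<Rightarrow> real \<Rightarrow> ('a \<Rightarrow> 'a) \<Rightarrow> real" where
  "scale_onorm D T s r A =
     (SUP u\<in>scale_space D T s. scale_norm D T r (A u) / scale_norm D T s u)"

text \<open>
  Iterated integral of \<open>F [\<tau>1, \<dots>, \<tau>n]\<close> over \<open>s \<ge> \<tau>1 \<ge> \<dots> \<ge> \<tau>n \<ge> 0\<close>, the outermost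
  variable being \<open>\<tau>1\<close>.
\<close>

primrec simplex_integral :: "nat \<Rightarrow> real \<Rightarrow> (real list \<Rightarrow> 'a::banach) \<Rightarrow> 'a" where
  "simplex_integral 0 s F = F []"
| "simplex_integral (Suc n) s F =
     integral {0..s} (\<lambda>\<tau>. simplex_integral n \<tau> (\<lambda>\<tau>s. F (\<tau> # \<tau>s)))"

text \<open>
  The operator-valued integral is evaluated on a vector: \<open>magnus_D A n u\<close> is the integral of
  the vector-valued function \<open>A \<tau>1 (A \<tau>2 (\<dots> (A \<tau>n u)))\<close>. For integrands that are
  norm continuous as operators between two spaces of the scale, this is the operator-valued
  integral applied to \<open>u\<close>.
\<close>

definition magnus_D :: "(real \<Rightarrow> 'a \<Rightarrow> 'a) \<Rightarrow> nat \<Rightarrow> 'a \<Rightarrow> 'a::complex_hilbert" where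
  "magnus_D A n u = simplex_integral n 1 (\<lambda>\<tau>s. foldr A \<tau>s u)"

definition compositions :: "nat \<Rightarrow> nat \<Rightarrow> nat list set" where
  "compositions m k = {ns. length ns = k \<and> (\<forall>n\<in>set ns. 1 \<le> n) \<and> sum_list ns = m}"

text \<open>
  Normalised by \<open>log (1 + (\<Sum>n\<ge>1. (- \<i> T)^n D_n)) = - \<i> T (\<Sum>l. T^l FM_l)\<close> as formal power
  series in \<open>T\<close>.
\<close>

definition magnus_FM :: "nat \<Rightarrow> (real \<Rightarrow> 'a \<Rightarrow> 'a) \<Rightarrow> 'a \<Rightarrow> 'a::complex_hilbert" where
  "magnus_FM l A u =
     (\<i> * (- \<i>) ^ (l + 1)) *\<^sub>C
       (\<Sum>k = 1..l + 1. ((- 1) ^ (k - 1) / of_nat k) *\<^sub>C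
          (\<Sum>ns\<in>compositions (l + 1) k. foldr (magnus_D A) ns u))"

text \<open>
  The truncated family \<open>P_N A(t) P_N\<close>, extended by zero from the range of \<open>P_N\<close> to the
  whole space.
\<close>

definition truncated ::
    "'a::complex_hilbert set \<Rightarrow> ('a \<Rightarrow> 'a) \<Rightarrow> (real \<Rightarrow> 'a \<Rightarrow> 'a) \<Rightarrow> real \<Rightarrow> real \<Rightarrow> 'a \<Rightarrow> 'a" where
  "truncated D T A N t u = spec_proj D T N (A t (spec_proj D T N u))"

end

theory Submission
  imports Defs
begin

text \<open>
  The orthogonal complement of all eigenspaces is invariant under the compact positive operator
  \<open>(1 + H0)\<^sup>-\<^sup>1\<close>, so it is trivial and the eigenspaces span. Hence \<open>(1 + H0)\<^sup>r\<close> identifies the space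
  of order \<open>r\<close> with the whole space and turns \<open>H t\<close> into bounded operators \<open>B q t\<close>, norm
  continuous on the unit interval, while \<open>P\<^sub>N\<close> commutes with this identification. In these
  coordinates every simplex integral becomes an iterated integral of products of the \<open>B q t\<close>,
  and the truncation replaces \<open>B q t\<close> by \<open>P\<^sub>N B q t P\<^sub>N\<close>. As \<open>P\<^sub>N\<close> is a contraction tending strongly
  to the identity, \<open>P\<^sub>N g\<close> tends to \<open>g\<close> uniformly for every continuous \<open>g\<close> on the unit interval;
  by induction on the number of factors the iterated integrals converge uniformly in their
  upper limit.
\<close>

section \<open>Projections in complex Hilbert spaces\<close>

lemma norm_scaleC [simp]: "norm (c *\<^sub>C x) = cmod c * norm (x::'a::complex_hilbert)"
proof -
  have right: "cinner y (c *\<^sub>C z) = c * cinner y z" for y z :: 'a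
    by (metis cinner_commute cinner_scaleC_left complex_cnj_cnj complex_cnj_mult)
  have eq: "c * (cnj c * cinner x x) = complex_of_real ((cmod c)\<^sup>2) * cinner x x"
    by (metis (no_types, lifting) complex_norm_square mult.assoc of_real_power)
  have "Re (c * (cnj c * cinner x x)) = (cmod c)\<^sup>2 * Re (cinner x x)"
    unfolding eq by simp
  then have "(norm (c *\<^sub>C x))\<^sup>2 = (cmod c)\<^sup>2 * (norm x)\<^sup>2"
    by (simp only: power2_norm_eq_inner[where 'a = 'a] inner_cinner cinner_scaleC_left right)
  then show ?thesis
    by (metis norm_ge_zero power2_eq_iff_nonneg power_mult_distrib mult_nonneg_nonneg)
qed

lemma bounded_linear_scaleC: "bounded_linear (\<lambda>x::'a::complex_hilbert. c *\<^sub>C x)"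
proof (rule bounded_linear_intro[where K = "cmod c"])
  show "c *\<^sub>C (r *\<^sub>R x) = r *\<^sub>R (c *\<^sub>C x)" for r and x :: 'a
    by (simp add: scaleR_scaleC scaleC_scaleC mult.commute)
qed (simp_all add: scaleC_add_right mult.commute)

lemma scaleC_diff_right: "c *\<^sub>C (x - y) = c *\<^sub>C x - c *\<^sub>C (y::'a::complex_hilbert)"
  by (rule linear_diff[OF bounded_linear.linear[OF bounded_linear_scaleC]])

lemma scaleC_left_commute_scaleR: "c *\<^sub>C r *\<^sub>R (x::'a::complex_hilbert) = r *\<^sub>R c *\<^sub>C x"
  by (simp add: scaleR_scaleC scaleC_scaleC mult.commute)

lemma scaleC_0_left [simp]: "0 *\<^sub>C (x::'a::complex_hilbert) = 0"
  by (metis norm_scaleC norm_eq_zero mult_zero_left norm_zero)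

lemma scaleC_minus_one [simp]: "(- 1) *\<^sub>C (x::'a::complex_hilbert) = - x"
proof -
  have "(- 1) *\<^sub>C x + x = (- 1 + 1) *\<^sub>C x"
    by (simp only: scaleC_add_left scaleC_one)
  then show ?thesis by (simp add: eq_neg_iff_add_eq_0)
qed

lemma cinner_scaleC_right: "cinner x (c *\<^sub>C y) = c * cinner x (y::'a::complex_hilbert)"
  by (metis cinner_commute cinner_scaleC_left complex_cnj_cnj complex_cnj_mult)

lemma cinner_add_right: "cinner x (y + z) = cinner x y + cinner x (z::'a::complex_hilbert)"
  by (metis cinner_commute cinner_add_left complex_cnj_add)

lemma cinner_eq_Complex_inner:
  "cinner x (y::'a::complex_hilbert) = Complex (inner x y) (inner (\<i> *\<^sub>C x) y)"
  by (simp add: complex_eq_iff inner_cinner cinner_scaleC_left)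

lemma cinner_scaleR_right: "cinner x (r *\<^sub>R y) = r *\<^sub>R cinner x (y::'a::complex_hilbert)"
  by (simp add: scaleR_scaleC cinner_scaleC_right scaleR_conv_of_real)

lemma cinner_scaleR_left: "cinner (r *\<^sub>R x) y = r *\<^sub>R cinner x (y::'a::complex_hilbert)"
  by (simp add: scaleR_scaleC cinner_scaleC_left scaleR_conv_of_real)

lemma cinner_diff_right: "cinner x (y - z) = cinner x y - cinner x (z::'a::complex_hilbert)"
  by (simp add: cinner_eq_Complex_inner inner_diff_right complex_eq_iff)

lemma cinner_zero_right [simp]: "cinner x (0::'a::complex_hilbert) = 0"
  by (simp add: cinner_eq_Complex_inner complex_eq_iff)

lemma cinner_eq_zero_commute: "cinner x y = 0 \<longleftrightarrow> cinner y (x::'a::complex_hilbert) = 0"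
  by (metis cinner_commute complex_cnj_zero)

lemma cinner_zero_left [simp]: "cinner 0 (x::'a::complex_hilbert) = 0"
  using cinner_eq_zero_commute[of 0 x] by simp

lemma cinner_diff_left: "cinner (x - y) z = cinner x z - cinner y (z::'a::complex_hilbert)"
  by (metis cinner_commute cinner_diff_right complex_cnj_diff)

lemma cinner_self: "cinner x x = complex_of_real ((norm (x::'a::complex_hilbert))\<^sup>2)"
proof -
  have "Im (cinner x x) = 0"
    using cinner_commute[of x x] by (metis complex_cnj_cancel_iff Reals_cnj_iff complex_is_Real_iff)
  moreover have "Re (cinner x x) = (norm x)\<^sup>2"
    by (simp add: power2_norm_eq_inner inner_cinner)
  ultimately show ?thesis by (simp add: complex_eq_iff)
qed

lemma tendsto_cinner_right:
  "(f \<longlongrightarrow> l) F \<Longrightarrow> ((\<lambda>n. cinner x (f n)) \<longlongrightarrow> cinner x (l::'a::complex_hilbert)) F"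
  unfolding cinner_eq_Complex_inner by (intro tendsto_Complex tendsto_intros)

lemma closed_cinner_eq: "closed {v::'a::complex_hilbert. cinner a v = cinner b v}"
proof -
  have "{v. cinner a v = cinner b v} =
      {v. inner a v = inner b v} \<inter> {v. inner (\<i> *\<^sub>C a) v = inner (\<i> *\<^sub>C b) v}"
    by (auto simp: cinner_eq_Complex_inner)
  then show ?thesis
    by (simp add: closed_Int closed_Collect_eq continuous_on_inner continuous_on_const continuous_on_id)
qed

section \<open>Closed complex subspaces and their orthogonal projections\<close>

definition closed_csubspace :: "'a::complex_hilbert set \<Rightarrow> bool" where
  "closed_csubspace S \<longleftrightarrow>
     closed S \<and> 0 \<in> S \<and> (\<forall>u\<in>S. \<forall>v\<in>S. u + v \<in> S) \<and> (\<forall>c. \<forall>u\<in>S. c *\<^sub>C u \<in> S)"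

lemma closed_csubspaceD:
  assumes "closed_csubspace S"
  shows "closed S" "0 \<in> S" "u \<in> S \<Longrightarrow> v \<in> S \<Longrightarrow> u + v \<in> S" "u \<in> S \<Longrightarrow> c *\<^sub>C u \<in> S"
    "u \<in> S \<Longrightarrow> r *\<^sub>R u \<in> S" "u \<in> S \<Longrightarrow> v \<in> S \<Longrightarrow> u - v \<in> S"
proof -
  show "closed S" "0 \<in> S" and add: "\<And>u v. u \<in> S \<Longrightarrow> v \<in> S \<Longrightarrow> u + v \<in> S"
    and scale: "\<And>c u. u \<in> S \<Longrightarrow> c *\<^sub>C u \<in> S"
    using assms by (auto simp: closed_csubspace_def)
  show "u \<in> S \<Longrightarrow> r *\<^sub>R u \<in> S" by (simp add: scaleR_scaleC scale)
  show "u - v \<in> S" if "u \<in> S" "v \<in> S"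
    using add[OF that(1) scale[OF that(2), of "- 1"]] by simp
qed

lemma closed_csubspace_subspace: "closed_csubspace S \<Longrightarrow> subspace S"
  by (auto simp: subspace_def intro: closed_csubspaceD)

text \<open>A minimising sequence is Cauchy by the parallelogram identity: midpoints stay in
  \<open>S\<close>, so their distance to \<open>u\<close> is at least the infimum \<open>d\<close>,
  which squeezes the two points together.\<close>

lemma closed_subspace_nearest_point:
  fixes S :: "'a::{real_inner,complete_space} set"
  assumes S: "subspace S" and "closed S"
  obtains v where "v \<in> S" "\<And>w. w \<in> S \<Longrightarrow> norm (u - v) \<le> norm (u - w)"
proof -
  define d where "d = infdist u S"
  have "S \<noteq> {}" using S subspace_0 by blast
  have d_le: "d \<le> norm (u - w)" if "w \<in> S" for w
    using infdist_le[OF that, of u] by (simp add: d_def dist_norm)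
  have d_ge: "0 \<le> d" by (simp add: d_def infdist_nonneg)
  have "\<exists>w\<in>S. norm (u - w) < d + 1 / Suc n" for n
  proof -
    have "(INF w\<in>S. dist u w) < d + 1 / Suc n"
      using \<open>S \<noteq> {}\<close> by (simp add: d_def infdist_def)
    then show ?thesis
      using \<open>S \<noteq> {}\<close> by (subst (asm) cINF_less_iff) (auto simp: dist_norm intro: bdd_belowI2[of _ 0])
  qed
  then obtain s where sS: "\<And>n. s n \<in> S" and s: "\<And>n::nat. norm (u - s n) < d + 1 / Suc n"
    by metis
  \<comment> \<open>Each squared distance exceeds \<open>d\<^sup>2\<close> by at most
    \<open>(2 * d + 1) / Suc k\<close>; the parallelogram identity counts this excess four
    times.\<close>
  have close: "(norm (s m - s n))\<^sup>2 \<le> (8 * d + 4) / Suc k" if "k \<le> m" "k \<le> n" for m n k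
  proof -
    have half: "(1/2) *\<^sub>R (s m + s n) \<in> S"
      using S sS by (meson subspace_add subspace_scale)
    have bd: "(norm (u - s j))\<^sup>2 \<le> d\<^sup>2 + (2 * d + 1) / Suc k" if "k \<le> j" for j
    proof -
      have "1 / real (Suc j) \<le> 1 / Suc k" using that by (simp add: frac_le)
      then have "norm (u - s j) \<le> d + 1 / Suc k" using s[of j] by linarith
      then have "(norm (u - s j))\<^sup>2 \<le> (d + 1 / Suc k)\<^sup>2"
        by (simp add: power_mono)
      also have "\<dots> = d\<^sup>2 + 2 * d / Suc k + (1 / Suc k) * (1 / Suc k)"
        by (simp add: power2_eq_square algebra_simps)
      also have "(1 / real (Suc k)) * (1 / Suc k) \<le> 1 * (1 / Suc k)"
        by (rule mult_right_mono) auto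
      finally show ?thesis by (simp add: add_divide_distrib)
    qed
    have "4 * d\<^sup>2 \<le> 4 * (norm (u - (1/2) *\<^sub>R (s m + s n)))\<^sup>2"
      using d_le[OF half] d_ge by (simp add: power_mono)
    also have "4 * (norm (u - (1/2) *\<^sub>R (s m + s n)))\<^sup>2 + (norm (s m - s n))\<^sup>2
        = 2 * (norm (u - s m))\<^sup>2 + 2 * (norm (u - s n))\<^sup>2"
      by (simp add: power2_norm_eq_inner inner_diff inner_add inner_commute algebra_simps)
    finally show ?thesis using bd[OF \<open>k \<le> m\<close>] bd[OF \<open>k \<le> n\<close>] by (simp add: add_divide_distrib)
  qed
  have "Cauchy s"
  proof (rule metric_CauchyI)
    fix e :: real assume "0 < e"
    obtain k :: nat where k: "(8 * d + 4) / e\<^sup>2 < k" using reals_Archimedean2 by blast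
    have "(8 * d + 4) / Suc k < e\<^sup>2"
      using k \<open>0 < e\<close> by (simp add: field_simps) (smt (verit) zero_less_power)
    then have "(norm (s m - s n))\<^sup>2 < e\<^sup>2" if "k \<le> m" "k \<le> n" for m n
      using close[OF that] by linarith
    then show "\<exists>M. \<forall>m\<ge>M. \<forall>n\<ge>M. dist (s m) (s n) < e"
      using \<open>0 < e\<close> by (metis dist_norm less_imp_le power2_less_imp_less)
  qed
  then obtain v where v: "s \<longlonglongrightarrow> v" using Cauchy_convergent_iff convergent_def by blast
  have "v \<in> S" using \<open>closed S\<close> sS v by (meson closed_sequentially)
  moreover have "norm (u - v) \<le> d"
  proof (rule LIMSEQ_le)
    show "(\<lambda>n. norm (u - s n)) \<longlonglongrightarrow> norm (u - v)" by (intro tendsto_intros v)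
    show "(\<lambda>n. d + 1 / Suc n) \<longlonglongrightarrow> d"
      using tendsto_add[OF tendsto_const LIMSEQ_Suc[OF lim_1_over_n]] by simp
  qed (use s less_imp_le in blast)
  ultimately show thesis using that d_le by (meson order_trans)
qed

text \<open>This makes the \<open>THE\<close> in \<open>orth_proj\<close> meaningful. At the nearest
  point the first variation vanishes, which gives orthogonality for the real inner product
  first.\<close>

lemma closed_csubspace_projection:
  assumes S: "closed_csubspace S"
  shows "\<exists>!v. v \<in> S \<and> (\<forall>w\<in>S. cinner w (u - v) = 0)"
proof -
  obtain v where v: "v \<in> S" and min: "\<And>w. w \<in> S \<Longrightarrow> norm (u - v) \<le> norm (u - w)"
    using closed_subspace_nearest_point[OF closed_csubspace_subspace[OF S] closed_csubspaceD(1)[OF S]]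
    by blast
  have "inner w (u - v) = 0" if w: "w \<in> S" for w
  proof (cases "w = 0")
    case False
    \<comment> \<open>This \<open>t\<close> minimises the quadratic polynomial
      \<open>(norm (u - (v + t *\<^sub>R w)))\<^sup>2\<close>, so minimality of \<open>v\<close>
      forces its linear term to vanish.\<close>
    define t where "t = inner w (u - v) / inner w w"
    have "v + t *\<^sub>R w \<in> S" using S v w by (intro closed_csubspaceD)
    then have "norm (u - v) \<le> norm (u - (v + t *\<^sub>R w))" by (rule min)
    then have "(norm (u - v))\<^sup>2 \<le> (norm (u - (v + t *\<^sub>R w)))\<^sup>2" by (simp add: power_mono)
    moreover have "(norm (u - (v + t *\<^sub>R w)))\<^sup>2
        = (norm (u - v))\<^sup>2 - 2 * t * inner w (u - v) + t * t * inner w w"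
      by (simp add: power2_norm_eq_inner inner_diff inner_add inner_commute algebra_simps)
    moreover have "t * inner w w = inner w (u - v)" using False by (simp add: t_def)
    ultimately have "t * inner w (u - v) \<le> 0" by (simp add: mult.assoc)
    then have "(inner w (u - v))\<^sup>2 / inner w w \<le> 0" by (simp add: t_def power2_eq_square)
    moreover have "0 < inner w w" using False by simp
    ultimately show ?thesis by (simp add: divide_le_0_iff)
  qed simp
  \<comment> \<open>Real orthogonality to \<open>\<i> *\<^sub>C w\<close>, which also lies in
    \<open>S\<close>, kills the imaginary part.\<close>
  then have "cinner w (u - v) = 0" if "w \<in> S" for w
    using that closed_csubspaceD(4)[OF S that] by (simp add: cinner_eq_Complex_inner complex_eq_iff)
  moreover have "v' = v" if "v' \<in> S" "\<forall>w\<in>S. cinner w (u - v') = 0" for v'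
  proof -
    have mem: "v - v' \<in> S" using S v that by (simp add: closed_csubspaceD)
    have "cinner (v - v') ((u - v') - (u - v)) = 0"
      unfolding cinner_diff_right[of _ "u - v'"] using that mem calculation by simp
    then have "norm (v - v') = 0" by (simp add: cinner_self)
    then show ?thesis by simp
  qed
  ultimately show ?thesis using v by blast
qed

lemma orth_proj_props:
  assumes "closed_csubspace S"
  shows orth_proj_mem: "orth_proj S u \<in> S"
    and orth_proj_orth: "w \<in> S \<Longrightarrow> cinner w (u - orth_proj S u) = 0"
    and orth_proj_eqI: "v \<in> S \<Longrightarrow> (\<And>w. w \<in> S \<Longrightarrow> cinner w (u - v) = 0) \<Longrightarrow> orth_proj S u = v"
proof -
  note ex1 = closed_csubspace_projection[OF assms, of u]
  show "orth_proj S u \<in> S" "w \<in> S \<Longrightarrow> cinner w (u - orth_proj S u) = 0"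
    using theI'[OF ex1] by (auto simp: orth_proj_def)
  show "v \<in> S \<Longrightarrow> (\<And>w. w \<in> S \<Longrightarrow> cinner w (u - v) = 0) \<Longrightarrow> orth_proj S u = v"
    unfolding orth_proj_def by (rule the1_equality[OF ex1]) auto
qed

lemma orth_proj_add:
  assumes S: "closed_csubspace S" shows "orth_proj S (u + v) = orth_proj S u + orth_proj S v"
proof (rule orth_proj_eqI[OF S])
  show "orth_proj S u + orth_proj S v \<in> S" by (intro closed_csubspaceD orth_proj_mem S)
  fix w assume w: "w \<in> S"
  have "u + v - (orth_proj S u + orth_proj S v) = (u - orth_proj S u) + (v - orth_proj S v)" by simp
  then show "cinner w (u + v - (orth_proj S u + orth_proj S v)) = 0"
    by (simp only: cinner_add_right orth_proj_orth[OF S w]) simp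
qed

lemma orth_proj_scaleC:
  assumes S: "closed_csubspace S" shows "orth_proj S (c *\<^sub>C u) = c *\<^sub>C orth_proj S u"
proof (rule orth_proj_eqI[OF S])
  show "c *\<^sub>C orth_proj S u \<in> S" by (intro closed_csubspaceD orth_proj_mem S)
  fix w assume w: "w \<in> S"
  show "cinner w (c *\<^sub>C u - c *\<^sub>C orth_proj S u) = 0"
    by (simp only: scaleC_diff_right[symmetric] cinner_scaleC_right orth_proj_orth[OF S w]) simp
qed

lemma norm_orth_proj_le:
  assumes S: "closed_csubspace S" shows "norm (orth_proj S u) \<le> norm u"
proof -
  have "cinner (orth_proj S u) (u - orth_proj S u) = 0"
    by (intro orth_proj_orth orth_proj_mem S)
  then have "inner (orth_proj S u) (u - orth_proj S u) = 0"
    by (simp add: inner_cinner)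
  then have "(norm u)\<^sup>2 = (norm (orth_proj S u))\<^sup>2 + (norm (u - orth_proj S u))\<^sup>2"
    using norm_add_Pythagorean[of "orth_proj S u" "u - orth_proj S u"] by (simp add: orthogonal_def)
  then show ?thesis by (simp add: power2_le_imp_le)
qed

lemma bounded_linear_orth_proj:
  assumes "closed_csubspace S" shows "bounded_linear (orth_proj S)"
  by (rule bounded_linear_intro[where K = 1])
     (simp_all add: assms orth_proj_add orth_proj_scaleC scaleR_scaleC norm_orth_proj_le)

lemma orth_proj_ident: "closed_csubspace S \<Longrightarrow> u \<in> S \<Longrightarrow> orth_proj S u = u"
  by (rule orth_proj_eqI) simp_all

section \<open>Completeness of the eigenspaces\<close>

locale pos_selfadjoint =
  fixes D :: "'a::complex_hilbert set" and T :: "'a \<Rightarrow> 'a"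
  assumes selfadj: "selfadjoint_operator D T"
    and pos: "positive_operator D T"
    and compact_res: "has_compact_resolvent D T"
begin

lemma lin_op: "linear_operator D T"
  using selfadj by (simp add: selfadjoint_operator_def densely_defined_operator_def)

lemma D_add: "u \<in> D \<Longrightarrow> v \<in> D \<Longrightarrow> u + v \<in> D"
  and T_add: "u \<in> D \<Longrightarrow> v \<in> D \<Longrightarrow> T (u + v) = T u + T v"
  and D_scaleC: "u \<in> D \<Longrightarrow> c *\<^sub>C u \<in> D"
  and T_scaleC: "u \<in> D \<Longrightarrow> T (c *\<^sub>C u) = c *\<^sub>C T u"
  and D_zero: "0 \<in> D"
  using lin_op by (auto simp: linear_operator_def)

lemma T_zero: "T 0 = 0"
  using T_scaleC[OF D_zero, of 0] by simp

lemma D_diff: "u \<in> D \<Longrightarrow> v \<in> D \<Longrightarrow> u - v \<in> D"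
  and T_diff: "u \<in> D \<Longrightarrow> v \<in> D \<Longrightarrow> T (u - v) = T u - T v"
  using D_add[of u "(- 1) *\<^sub>C v"] T_add[of u "(- 1) *\<^sub>C v"] D_scaleC[of v "- 1"] T_scaleC[of v "- 1"]
  by simp_all

text \<open>Self-adjointness as a membership test: a weak equation against all of \<open>D\<close>
  already puts \<open>u\<close> into \<open>D\<close>. Limits and residuals enter the domain this
  way.\<close>

lemma in_D_iff: "u \<in> D \<and> T u = w \<longleftrightarrow> (\<forall>x\<in>D. cinner (T x) u = cinner x w)"
proof -
  have "adjoint_graph D T = graph_of D T"
    using selfadj by (simp add: selfadjoint_operator_def)
  then have "(u, w) \<in> adjoint_graph D T \<longleftrightarrow> (u, w) \<in> graph_of D T" by simp
  then show ?thesis by (auto simp: adjoint_graph_def graph_of_def)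
qed

lemma cinner_T: "u \<in> D \<Longrightarrow> v \<in> D \<Longrightarrow> cinner (T u) v = cinner u (T v)"
  using in_D_iff by blast

lemma Re_cinner_T_ge0: "u \<in> D \<Longrightarrow> 0 \<le> Re (cinner u (T u))"
  using pos by (simp add: positive_operator_def)

abbreviation eig :: "real \<Rightarrow> 'a set" where "eig \<equiv> eigenspace D T"
abbreviation ev :: "real set" where "ev \<equiv> eigenvalues D T"
abbreviation p :: "real \<Rightarrow> 'a \<Rightarrow> 'a" where "p x \<equiv> orth_proj (eig x)"

text \<open>\<open>T\<close> may be unbounded, but in weak form the eigenvalue equation is a family
  of conditions continuous in \<open>u\<close>, hence closed.\<close>

lemma closed_csubspace_eigenspace: "closed_csubspace (eig x)"
proof -
  have "eig x = (\<Inter>w\<in>D. {u. cinner (T w) u = cinner (x *\<^sub>R w) u})"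
    unfolding eigenspace_def
    using in_D_iff by (auto simp: cinner_scaleR_left cinner_scaleR_right)
  then have "closed (eig x)" by (auto intro: closed_INT closed_cinner_eq)
  then show ?thesis
    unfolding closed_csubspace_def eigenspace_def
    by (auto simp: D_zero T_zero D_add T_add D_scaleC T_scaleC scaleR_add_right
        scaleC_left_commute_scaleR)
qed

lemma eigenspace_orthogonal:
  assumes "u \<in> eig x" "v \<in> eig y" "x \<noteq> y" shows "cinner u v = 0"
proof -
  have "x *\<^sub>R cinner u v = y *\<^sub>R cinner u v"
    using cinner_T[of u v] assms(1,2)
    by (simp add: eigenspace_def cinner_scaleR_left cinner_scaleR_right)
  with \<open>x \<noteq> y\<close> show ?thesis by simp
qed

section \<open>Positivity and the bounded inverse of \<open>T + 1\<close>\<close>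

lemma eigenvalue_nonneg:
  assumes "x \<in> ev" shows "0 \<le> x"
proof -
  obtain u where u: "u \<in> eig x" "u \<noteq> 0"
    using assms by (auto simp: eigenvalues_def)
  have "0 \<le> x * (norm u)\<^sup>2"
    using Re_cinner_T_ge0[of u] u by (simp add: eigenspace_def cinner_scaleR_right cinner_self)
  then show ?thesis using \<open>u \<noteq> 0\<close> by (simp add: zero_le_mult_iff)
qed

text \<open>Positivity bounds \<open>inner u (T u + u)\<close> below by the squared norm, and
  Cauchy-Schwarz turns this into a lower bound for \<open>T + 1\<close>. Injectivity, closed range
  and contractivity of the inverse all come from it.\<close>

lemma norm_le_norm_shift: "u \<in> D \<Longrightarrow> norm u \<le> norm (T u + u)"
proof (cases "u = 0")
  case False
  assume u: "u \<in> D"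
  have "norm u * norm u \<le> inner u (T u + u)"
    using Re_cinner_T_ge0[OF u]
    by (simp add: inner_add_right inner_cinner[symmetric] flip: power2_norm_eq_inner power2_eq_square)
  also have "\<dots> \<le> norm u * norm (T u + u)" by (rule norm_cauchy_schwarz)
  finally show ?thesis using False by simp
qed simp

text \<open>By the lower bound, preimages of a convergent sequence are Cauchy.\<close>

lemma shift_range_closed: "closed_csubspace {T u + u |u. u \<in> D}" (is "closed_csubspace ?R")
proof -
  have closed: "closed ?R"
    unfolding closed_sequential_limits
  proof (intro allI impI)
    fix v l assume "(\<forall>n. v n \<in> ?R) \<and> v \<longlonglongrightarrow> l"
    then obtain u where u: "\<And>n. u n \<in> D" and v: "\<And>n. v n = T (u n) + u n" and l: "v \<longlonglongrightarrow> l"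
      by simp metis
    have "norm (u m - u n) \<le> norm (v m - v n)" for m n
      using norm_le_norm_shift[OF D_diff[OF u u], of m n] by (simp add: v T_diff u algebra_simps)
    then have "Cauchy u"
      using LIMSEQ_imp_Cauchy[OF l] unfolding Cauchy_def dist_norm
      by (meson le_less_trans)
    then obtain k where k: "u \<longlonglongrightarrow> k" using Cauchy_convergent_iff convergent_def by blast
    \<comment> \<open>\<open>T\<close> need not be continuous, so its equation is passed to the
      limit after moving \<open>T\<close> to the test vector \<open>w\<close>.\<close>
    have "cinner (T w) k = cinner w (l - k)" if w: "w \<in> D" for w
    proof (rule LIMSEQ_unique)
      show "(\<lambda>n. cinner (T w) (u n)) \<longlonglongrightarrow> cinner (T w) k" by (rule tendsto_cinner_right[OF k])
      have "cinner (T w) (u n) = cinner w (v n - u n)" for n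
        using cinner_T[OF w u] by (simp add: v)
      then show "(\<lambda>n. cinner (T w) (u n)) \<longlonglongrightarrow> cinner w (l - k)"
        using tendsto_cinner_right[OF tendsto_diff[OF l k]] by simp
    qed
    then have "k \<in> D" "T k = l - k" using in_D_iff by blast+
    then show "l \<in> ?R" by force
  qed
  have "c *\<^sub>C v \<in> ?R" if "v \<in> ?R" for c v
  proof -
    obtain u where "u \<in> D" "v = T u + u" using \<open>v \<in> ?R\<close> by blast
    then have "c *\<^sub>C u \<in> D" "c *\<^sub>C v = T (c *\<^sub>C u) + c *\<^sub>C u"
      by (simp_all add: D_scaleC T_scaleC scaleC_add_right)
    then show ?thesis by blast
  qed
  moreover have "v + v' \<in> ?R" if "v \<in> ?R" "v' \<in> ?R" for v v'
  proof -
    obtain u u' where "u \<in> D" "v = T u + u" "u' \<in> D" "v' = T u' + u'" using \<open>v \<in> ?R\<close> \<open>v' \<in> ?R\<close> by blast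
    then have "u + u' \<in> D" "v + v' = T (u + u') + (u + u')"
      by (simp_all add: D_add T_add)
    then show ?thesis by blast
  qed
  moreover have "0 \<in> ?R" using D_zero T_zero by force
  ultimately show ?thesis using closed by (simp add: closed_csubspace_def)
qed

text \<open>The part of \<open>v\<close> orthogonal to the range is annihilated by the adjoint of
  \<open>T + 1\<close>, hence by \<open>T + 1\<close> itself, and so vanishes by the lower
  bound.\<close>

lemma ex1_shift: "\<exists>!u. u \<in> D \<and> T u + u = v"
proof -
  let ?R = "{T u + u |u. u \<in> D}"
  define w where "w = v - orth_proj ?R v"
  have orth: "cinner (T x + x) w = 0" if "x \<in> D" for x
    using orth_proj_orth[OF shift_range_closed, of "T x + x" v] that by (auto simp: w_def)
  have "cinner (T x) w = cinner x (- w)" if "x \<in> D" for x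
  proof -
    have "cinner x (- w) = - cinner x w" using cinner_scaleC_right[of x "- 1" w] by simp
    then show ?thesis using orth[OF that] by (metis cinner_add_left eq_neg_iff_add_eq_0)
  qed
  then have "w \<in> D" "T w = - w" using in_D_iff by blast+
  then have "w = 0" using norm_le_norm_shift[of w] by simp
  then have "v \<in> ?R" using orth_proj_mem[OF shift_range_closed, of v] by (simp add: w_def)
  moreover have "u = u'" if "u \<in> D" "u' \<in> D" "T u + u = T u' + u'" for u u'
    using norm_le_norm_shift[OF D_diff[OF that(1,2)]] that by (simp add: T_diff algebra_simps)
  ultimately show ?thesis by blast
qed

text \<open>The resolvent at \<open>-1\<close>, which is always available here; the compactness
  hypothesis only names some point \<open>z\<close> of the resolvent set.\<close>

definition K :: "'a \<Rightarrow> 'a" where "K v = (THE u. u \<in> D \<and> T u + u = v)"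

lemma K_mem: "K v \<in> D" and T_K: "T (K v) = v - K v"
  using theI'[OF ex1_shift[of v]] by (auto simp: K_def algebra_simps)

lemma K_eqI: "u \<in> D \<Longrightarrow> T u + u = v \<Longrightarrow> K v = u"
  unfolding K_def by (rule the1_equality[OF ex1_shift]) simp

lemma K_add: "K (u + v) = K u + K v"
  by (rule K_eqI) (simp_all add: D_add K_mem T_add T_K)

lemma K_scaleC: "K (c *\<^sub>C u) = c *\<^sub>C K u"
  by (rule K_eqI) (simp_all add: D_scaleC K_mem T_scaleC T_K scaleC_diff_right)

lemma norm_K_le: "norm (K v) \<le> norm v"
  using norm_le_norm_shift[OF K_mem, of v] by (simp add: T_K)

lemma bounded_linear_K: "bounded_linear K"
  by (rule bounded_linear_intro[where K = 1]) (simp_all add: K_add K_scaleC scaleR_scaleC norm_K_le)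

lemma K_scaleR: "K (r *\<^sub>R u) = r *\<^sub>R K u"
  and K_diff: "K (u - v) = K u - K v"
  using linear_cmul linear_diff bounded_linear.linear[OF bounded_linear_K] by blast+

lemma cinner_K: "cinner (K u) v = cinner u (K v)"
proof -
  have "cinner (T (K u)) (K v) = cinner (K u) (T (K v))" by (rule cinner_T[OF K_mem K_mem])
  then show ?thesis by (simp add: T_K cinner_diff_left cinner_diff_right)
qed

lemma inner_K: "inner (K u) v = inner u (K v)"
  by (simp add: inner_cinner cinner_K)

lemma inner_K_ge0: "0 \<le> inner u (K u)"
proof -
  have "inner u (K u) = inner (K u) (T (K u)) + inner (K u) (K u)"
    by (simp add: T_K inner_diff_right inner_commute)
  moreover have "0 \<le> inner (K u) (T (K u))"
    using Re_cinner_T_ge0[OF K_mem] by (simp add: inner_cinner)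
  ultimately show ?thesis by simp
qed

lemma K_eq_0: "K v = 0 \<Longrightarrow> v = 0"
  using T_K[of v] by (simp add: T_zero)

text \<open>Resolvent identity: \<open>K\<close> is the compact resolvent at \<open>z\<close> composed with a bounded operator.\<close>
lemma K_compact:
  assumes bd: "\<And>n. norm (v n) \<le> 1"
  obtains k l where "strict_mono (k :: nat \<Rightarrow> nat)" "(\<lambda>n. K (v (k n))) \<longlonglongrightarrow> l"
proof -
  obtain z where z: "z \<in> resolvent_set D T"
    and cpt: "compact (closure (resolvent D T z ` cball 0 1))"
    using compact_res by (auto simp: has_compact_resolvent_def)
  define R where "R = resolvent D T z"
  \<comment> \<open>With this \<open>a\<close>, \<open>v + a *\<^sub>C K v\<close> equals
    \<open>T (K v) - z *\<^sub>C K v\<close>. The constant \<open>c\<close> then scales these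
    vectors into the unit ball, on which the resolvent is compact.\<close>
  define a where "a = - 1 - z"
  define c where "c = 1 + cmod a"
  have "0 < c" by (simp add: c_def add_pos_nonneg)
  have inj: "inj_on (\<lambda>u. T u - z *\<^sub>C u) D" and lin: "bounded_linear R"
    using z by (auto simp: resolvent_set_def R_def bij_betw_def)
  define w where "w n = v n + a *\<^sub>C K (v n)" for n
  have K_eq: "K (v n) = R (w n)" for n
  proof -
    have "w n = T (K (v n)) - z *\<^sub>C K (v n)"
    proof -
      have "a *\<^sub>C K (v n) = - K (v n) - z *\<^sub>C K (v n)"
        using scaleC_add_left[of a z "K (v n)"] by (simp add: a_def algebra_simps)
      then show ?thesis by (simp add: w_def T_K)
    qed
    then show ?thesis
      using inv_into_f_f[OF inj K_mem[of "v n"]] by (simp add: R_def resolvent_def)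
  qed
  have "norm (w n) \<le> norm (v n) + cmod a * norm (K (v n))" for n
    unfolding w_def by (metis norm_triangle_ineq norm_scaleC)
  also have "\<dots> n \<le> 1 + cmod a * 1" for n
    using bd[of n] norm_K_le[of "v n"] by (intro add_mono mult_left_mono) auto
  finally have "(1 / c) *\<^sub>R w n \<in> cball 0 1" for n
    using \<open>0 < c\<close> by (simp add: c_def)
  then have "R ((1 / c) *\<^sub>R w n) \<in> closure (R ` cball 0 1)" for n
    using closure_subset by blast
  then obtain l k where k: "strict_mono (k :: nat \<Rightarrow> nat)"
    and lim: "((\<lambda>n. R ((1 / c) *\<^sub>R w n)) \<circ> k) \<longlonglongrightarrow> l"
    using cpt unfolding compact_def R_def by meson
  have "(\<lambda>n. c *\<^sub>R R ((1 / c) *\<^sub>R w (k n))) \<longlonglongrightarrow> c *\<^sub>R l"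
    using lim by (intro tendsto_intros) (simp add: comp_def)
  moreover have "c *\<^sub>R R ((1 / c) *\<^sub>R x) = R x" for x
    using \<open>0 < c\<close> by (simp add: linear_cmul[OF bounded_linear.linear[OF lin]])
  ultimately have "(\<lambda>n. K (v (k n))) \<longlonglongrightarrow> c *\<^sub>R l" by (simp add: K_eq)
  with k show thesis by (rule that)
qed

section \<open>Triviality of the orthogonal complement of the eigenspaces\<close>

definition M :: "'a set" where "M = {v. \<forall>x. \<forall>w\<in>eig x. cinner w v = 0}"

lemma closed_M: "closed M"
proof -
  have "closed (\<Inter>x. \<Inter>w\<in>eig x. {v. cinner w v = cinner 0 v})"
    by (intro closed_INT ballI closed_cinner_eq)
  also have "(\<Inter>x. \<Inter>w\<in>eig x. {v. cinner w v = cinner 0 v}) = M"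
    by (auto simp: M_def)
  finally show ?thesis .
qed

lemma M_add: "u \<in> M \<Longrightarrow> v \<in> M \<Longrightarrow> u + v \<in> M"
  and M_scaleR: "u \<in> M \<Longrightarrow> r *\<^sub>R u \<in> M"
  by (auto simp: M_def cinner_add_right cinner_scaleR_right)

lemma K_eigenvector: "w \<in> eig x \<Longrightarrow> (1 + x) *\<^sub>R K w = w"
proof -
  assume w: "w \<in> eig x"
  then have "K (T w + w) = w" by (intro K_eqI) (auto simp: eigenspace_def)
  moreover have "T w + w = (1 + x) *\<^sub>R w" using w by (simp add: eigenspace_def algebra_simps)
  ultimately show ?thesis by (simp add: K_scaleR)
qed

text \<open>\<open>K\<close> maps every eigenspace of \<open>T\<close> into itself; its symmetry
  then carries the orthogonal complement into itself.\<close>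

lemma K_M: assumes "v \<in> M" shows "K v \<in> M"
  unfolding M_def
proof safe
  fix x w assume w: "w \<in> eig x"
  have "K w \<in> eig x"
  proof (cases "w = 0")
    case True
    then show ?thesis
      using w K_eqI[OF D_zero, of 0] T_zero by simp
  next
    case False
    have "1 + x \<noteq> 0"
    proof
      assume "1 + x = 0"
      with K_eigenvector[OF w] False show False by simp
    qed
    then have "K w = (1 / (1 + x)) *\<^sub>R w"
      using arg_cong[OF K_eigenvector[OF w], of "\<lambda>y. (1 / (1 + x)) *\<^sub>R y"] by simp
    then show ?thesis
      by (simp only: closed_csubspaceD(5)[OF closed_csubspace_eigenspace w])
  qed
  then show "cinner w (K v) = 0"
    using assms by (simp add: M_def cinner_K[symmetric])
qed

text \<open>Such a \<open>w\<close> would be an eigenvector of \<open>T\<close> for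
  \<open>1 / c - 1\<close>, and so orthogonal to itself. The membership is shown for
  \<open>K w\<close>, which lies in \<open>D\<close> by construction.\<close>

lemma K_no_eigenvector_in_M:
  assumes "w \<in> M" "K w = c *\<^sub>R w" "0 < c" shows "w = 0"
proof -
  have "K w \<in> eig (1 / c - 1)"
  proof -
    have "T (K w) = (1 / c) *\<^sub>R K w - K w" unfolding T_K using assms by simp
    then show ?thesis by (simp add: eigenspace_def K_mem algebra_simps)
  qed
  then have "cinner (K w) w = 0" using assms(1) by (simp add: M_def)
  then show "w = 0"
    using assms by (simp add: cinner_scaleR_left cinner_self)
qed

text \<open>Maximising \<open>norm (K x)\<close> over the unit vectors of \<open>M\<close> yields an eigenvector of \<open>K\<^sup>2\<close>,
  and positivity of \<open>K\<close> splits off an eigenvector of \<open>K\<close> itself.\<close>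
lemma eigenspaces_total:
  assumes "v \<in> M" shows "v = 0"
proof (rule ccontr)
  assume "v \<noteq> 0"
  define S where "S = (\<lambda>x. norm (K x)) ` {x\<in>M. norm x = 1}"
  define c where "c = Sup S"
  define v1 where "v1 = (1 / norm v) *\<^sub>R v"
  have v1: "v1 \<in> M" "norm v1 = 1"
    using assms \<open>v \<noteq> 0\<close> by (simp_all add: v1_def M_scaleR)
  have bdd: "bdd_above S"
  proof (rule bdd_aboveI[of _ 1])
    fix b assume "b \<in> S"
    then obtain x where "norm x = 1" "b = norm (K x)" by (auto simp: S_def)
    then show "b \<le> 1" using norm_K_le[of x] by simp
  qed
  have "S \<noteq> {}" using v1 by (auto simp: S_def)
  have c_ge: "norm (K x) \<le> c" if "x \<in> M" "norm x = 1" for x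
    unfolding c_def by (rule cSup_upper[OF _ bdd]) (use that in \<open>auto simp: S_def\<close>)
  have "K v1 \<noteq> 0" using K_eq_0[of v1] v1 by auto
  then have "0 < c" using c_ge[OF v1] by (meson less_le_trans zero_less_norm_iff)
  have K_le: "norm (K x) \<le> c * norm x" if "x \<in> M" for x
  proof (cases "x = 0")
    case True
    then show ?thesis using norm_K_le[of 0] by simp
  next
    case False
    have "norm (K ((1 / norm x) *\<^sub>R x)) \<le> c"
      by (rule c_ge) (use that False in \<open>auto intro: M_scaleR\<close>)
    then show ?thesis
      using False by (simp add: K_scaleR field_simps)
  qed
  \<comment> \<open>The defect in the eigenvalue equation for \<open>K\<^sup>2\<close> is controlled
    by the gap between \<open>norm (K x)\<close> and its supremum \<open>c\<close>, so it vanishes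
    along a maximising sequence.\<close>
  have defect: "(norm (K (K x) - c\<^sup>2 *\<^sub>R x))\<^sup>2 \<le> c\<^sup>2 * (c\<^sup>2 - (norm (K x))\<^sup>2)"
    if x: "x \<in> M" "norm x = 1" for x
  proof -
    have "(norm (K (K x) - c\<^sup>2 *\<^sub>R x))\<^sup>2
        = (norm (K (K x)))\<^sup>2 - 2 * c\<^sup>2 * (norm (K x))\<^sup>2 + c\<^sup>2 * c\<^sup>2 * (norm x)\<^sup>2"
      using inner_K[of "K x" x]
      by (simp add: power2_norm_eq_inner inner_diff inner_commute algebra_simps)
    also have "(norm (K (K x)))\<^sup>2 \<le> c\<^sup>2 * (norm (K x))\<^sup>2"
      using power_mono[OF K_le[OF K_M[OF x(1)]], of 2] by (simp add: power_mult_distrib)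
    finally show ?thesis using x by (simp add: algebra_simps)
  qed
  have "\<exists>x\<in>M. norm x = 1 \<and> c - 1 / Suc n < norm (K x)" for n
  proof -
    have "c - 1 / Suc n < Sup S" by (simp add: c_def)
    then obtain y where "y \<in> S" "c - 1 / Suc n < y"
      using less_cSup_iff[OF \<open>S \<noteq> {}\<close> bdd] by blast
    then show ?thesis by (auto simp: S_def)
  qed
  then obtain x where xM: "\<And>n. x n \<in> M" and x1: "\<And>n. norm (x n) = 1"
    and xc: "\<And>n::nat. c - 1 / Suc n < norm (K (x n))"
    by metis
  have lim_norm: "(\<lambda>n. norm (K (x n))) \<longlonglongrightarrow> c"
  proof (rule tendsto_sandwich[OF _ _ _ tendsto_const])
    show "(\<lambda>n. c - 1 / Suc n) \<longlonglongrightarrow> c"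
      using tendsto_diff[OF tendsto_const LIMSEQ_Suc[OF lim_1_over_n], of c] by simp
  qed (use xc c_ge xM x1 in \<open>simp_all add: less_imp_le\<close>)
  \<comment> \<open>Compactness yields a limit of \<open>K (x n)\<close> along a subsequence, not of
    \<open>x n\<close>, so this limit \<open>y\<close> serves as the eigenvector of
    \<open>K\<^sup>2\<close>; it is nonzero because its norm is \<open>c\<close>.\<close>
  obtain k y where k: "strict_mono (k :: nat \<Rightarrow> nat)" and y: "(\<lambda>n. K (x (k n))) \<longlonglongrightarrow> y"
    using K_compact[of x] x1 by (metis order_refl)
  have "norm y = c"
    using LIMSEQ_unique[OF tendsto_norm[OF y]] LIMSEQ_subseq_LIMSEQ[OF lim_norm k] by (simp add: comp_def)
  have "y \<in> M" using closed_M y xM K_M by (meson closed_sequentially)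
  have "(\<lambda>n. (norm (K (K (x n)) - c\<^sup>2 *\<^sub>R x n))\<^sup>2) \<longlonglongrightarrow> 0"
  proof (rule tendsto_sandwich[OF _ _ tendsto_const])
    show "(\<lambda>n. c\<^sup>2 * (c\<^sup>2 - (norm (K (x n)))\<^sup>2)) \<longlonglongrightarrow> 0"
      using tendsto_mult[OF tendsto_const tendsto_diff[OF tendsto_const tendsto_power[OF lim_norm]],
        of "c\<^sup>2" "c\<^sup>2" 2] by simp
  qed (use defect xM x1 in auto)
  then have "(\<lambda>n. K (K (x n)) - c\<^sup>2 *\<^sub>R x n) \<longlonglongrightarrow> 0"
    using tendsto_real_sqrt[of "\<lambda>n. (norm (K (K (x n)) - c\<^sup>2 *\<^sub>R x n))\<^sup>2" 0 sequentially]
    by (simp add: tendsto_norm_zero_iff)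
  then have "(\<lambda>n. K (K (x (k n))) - c\<^sup>2 *\<^sub>R x (k n)) \<longlonglongrightarrow> 0"
    by (rule LIMSEQ_subseq_LIMSEQ[OF _ k, unfolded comp_def])
  \<comment> \<open>Applying \<open>K\<close> once more expresses the residual through
    \<open>K (x (k n))\<close>, which converges.\<close>
  then have "(\<lambda>n. K (K (K (x (k n))) - c\<^sup>2 *\<^sub>R x (k n))) \<longlonglongrightarrow> K 0"
    by (rule bounded_linear.tendsto[OF bounded_linear_K])
  moreover have "(\<lambda>n. K (K (K (x (k n))) - c\<^sup>2 *\<^sub>R x (k n))) \<longlonglongrightarrow> K (K y) - c\<^sup>2 *\<^sub>R y"
    unfolding K_diff
      K_scaleR
    by (intro tendsto_intros y bounded_linear.tendsto[OF bounded_linear_K])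
  ultimately have KK: "K (K y) = c\<^sup>2 *\<^sub>R y"
    using LIMSEQ_unique K_eqI[OF D_zero, of 0] T_zero by fastforce
  \<comment> \<open>Factor \<open>K\<^sup>2 - c\<^sup>2\<close> as \<open>(K - c) (K + c)\<close>:
    the vector \<open>(K + c) y\<close> lies in the kernel of \<open>K - c\<close>. If it vanishes,
    then \<open>K y = - c y\<close>, which positivity of \<open>K\<close> forbids.\<close>
  define w where "w = K y + c *\<^sub>R y"
  have "K w = c *\<^sub>R w"
    by (simp add: w_def K_add KK K_scaleR
        power2_eq_square scaleR_add_right add.commute)
  moreover have "w \<in> M" using \<open>y \<in> M\<close> by (simp add: w_def K_M M_add M_scaleR)
  ultimately have "w = 0" using \<open>0 < c\<close> K_no_eigenvector_in_M by blast
  then have "inner y w = 0" by simp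
  then have "c * (norm y)\<^sup>2 \<le> 0"
    using inner_K_ge0[of y] by (simp add: w_def inner_add_right power2_norm_eq_inner)
  then show False using \<open>0 < c\<close> \<open>norm y = c\<close> by (simp add: mult_le_0_iff)
qed

end

section \<open>Functional calculus and the scale\<close>

text \<open>By Pythagoras the tails of the vector sum are measured by tails of the sum of squares,
  so the net of finite sums is Cauchy. The index set is arbitrary, so no enumeration of the
  eigenvalues has to be chosen.\<close>

lemma summable_on_orthogonal:
  fixes v :: "'i \<Rightarrow> 'a::{real_inner,complete_space}"
  assumes orth: "pairwise (\<lambda>i j. orthogonal (v i) (v j)) A"
    and sq: "(\<lambda>i. (norm (v i))\<^sup>2) summable_on A"
  shows "v summable_on A"
proof -
  define q where "q = (\<lambda>i. (norm (v i))\<^sup>2)"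
  have q_ge0: "0 \<le> q i" for i by (simp add: q_def)
  have "\<exists>P. eventually P (finite_subsets_at_top A) \<and>
      (\<forall>F F'. P F \<and> P F' \<longrightarrow> dist (sum v F) (sum v F') < e)" if "0 < e" for e
  proof -
    \<comment> \<open>\<open>e\<^sup>2 / 8\<close> stays strictly below
      \<open>(e / 2)\<^sup>2\<close>, so each later sum is within \<open>e / 2\<close> of the one
      over \<open>G\<close>.\<close>
    obtain G where G: "finite G" "G \<subseteq> A" and approx: "dist (sum q G) (infsum q A) \<le> e\<^sup>2 / 8"
      using has_sum_finite_approximation[OF has_sum_infsum[OF sq], of "e\<^sup>2 / 8"] \<open>0 < e\<close>
      unfolding q_def by auto
    define P where "P F \<longleftrightarrow> finite F \<and> G \<subseteq> F \<and> F \<subseteq> A" for F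
    have near: "norm (sum v F - sum v G) < e / 2" if "P F" for F
    proof -
      have F: "finite F" "G \<subseteq> F" "F \<subseteq> A" using that by (auto simp: P_def)
      have "(norm (sum v F - sum v G))\<^sup>2 = (norm (sum v (F - G)))\<^sup>2"
        using F by (simp add: sum_diff)
      also have "\<dots> = sum q (F - G)"
        unfolding q_def using F orth by (intro norm_sum_Pythagorean) (auto intro: pairwise_subset)
      also have "\<dots> = sum q F - sum q G" using F by (simp add: sum_diff)
      also have "sum q F \<le> infsum q A"
        using F q_ge0 sq by (intro finite_sum_le_infsum) (auto simp: q_def)
      also have "infsum q A - sum q G \<le> e\<^sup>2 / 8" using approx unfolding dist_real_def by linarith
      also have "e\<^sup>2 / 8 < (e / 2)\<^sup>2" using \<open>0 < e\<close> by (simp add: power2_eq_square)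
      finally have "(norm (sum v F - sum v G))\<^sup>2 < (e / 2)\<^sup>2" by simp
      from power2_less_imp_less[OF this] show ?thesis using \<open>0 < e\<close> by simp
    qed
    have "dist (sum v F) (sum v F') < e" if "P F" "P F'" for F F'
    proof -
      have "dist (sum v F) (sum v F') \<le> dist (sum v F) (sum v G) + dist (sum v F') (sum v G)"
        by (rule dist_triangle2)
      then show ?thesis using near[OF that(1)] near[OF that(2)] by (simp add: dist_norm)
    qed
    moreover have "eventually P (finite_subsets_at_top A)"
      unfolding eventually_finite_subsets_at_top P_def using G by blast
    ultimately show ?thesis by blast
  qed
  then have "cauchy_filter (filtermap (sum v) (finite_subsets_at_top A))"
    by (simp add: cauchy_filter_metric_filtermap)
  moreover have "complete (UNIV :: 'a set)"
    by (meson Cauchy_convergent UNIV_I complete_def convergent_def)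
  ultimately obtain l where "(sum v \<longlongrightarrow> l) (finite_subsets_at_top A)"
    using complete_uniform[where S = UNIV] by (force simp: filterlim_def)
  then show ?thesis using summable_on_def has_sum_def by blast
qed

context pos_selfadjoint
begin

section \<open>Expansion along the eigenspaces and functions of \<open>T\<close>\<close>

lemma bounded_linear_p: "bounded_linear (p x)"
  and p_mem: "p x u \<in> eig x"
  and p_scaleC: "p x (c *\<^sub>C u) = c *\<^sub>C p x u"
  by (simp_all add: closed_csubspace_eigenspace bounded_linear_orth_proj orth_proj_mem
      orth_proj_scaleC)

lemma p_add: "p x (u + v) = p x u + p x v"
  and p_diff: "p x (u - v) = p x u - p x v"
  and p_scaleR: "p x (r *\<^sub>R u) = r *\<^sub>R p x u"
  using linear_add linear_diff linear_cmul bounded_linear.linear[OF bounded_linear_p] by blast+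

lemma p_p: "p x (p y u) = (if x = y then p x u else 0)"
proof (cases "x = y")
  case True
  then show ?thesis
    by (simp add: orth_proj_ident[OF closed_csubspace_eigenspace p_mem])
next
  case False
  have "p x (p y u) = 0"
  proof (rule orth_proj_eqI[OF closed_csubspace_eigenspace])
    show "0 \<in> eig x" by (rule closed_csubspaceD(2)[OF closed_csubspace_eigenspace])
    show "cinner w (p y u - 0) = 0" if "w \<in> eig x" for w
      using eigenspace_orthogonal[OF that p_mem[of y u] False] by simp
  qed
  with False show ?thesis by simp
qed

lemma pairwise_orthogonal_p:
  "pairwise (\<lambda>x y. orthogonal (f x *\<^sub>R p x u) (g y *\<^sub>R p y u)) A"
proof (rule pairwiseI)
  fix x y :: real assume "x \<noteq> y"
  then have "cinner (p x u) (p y u) = 0" using eigenspace_orthogonal p_mem by blast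
  then have "inner (p x u) (p y u) = 0" by (simp add: inner_cinner)
  then show "orthogonal (f x *\<^sub>R p x u) (g y *\<^sub>R p y u)" by (simp add: orthogonal_def)
qed

lemma norm_sum_p:
  assumes "finite F" shows "(norm (\<Sum>x\<in>F. f x *\<^sub>R p x u))\<^sup>2 = (\<Sum>x\<in>F. (f x * norm (p x u))\<^sup>2)"
  using norm_sum_Pythagorean[OF assms pairwise_orthogonal_p] by (simp add: power_mult_distrib)

lemma Bessel:
  assumes "finite F" shows "(\<Sum>x\<in>F. (norm (p x u))\<^sup>2) \<le> (norm u)\<^sup>2"
proof -
  let ?s = "\<Sum>x\<in>F. p x u"
  have "inner (p x u) (u - p x u) = 0" for x
    using orth_proj_orth[OF closed_csubspace_eigenspace p_mem] by (simp add: inner_cinner)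
  then have "inner (p x u) u = (norm (p x u))\<^sup>2" for x
    by (simp add: inner_diff_right power2_norm_eq_inner)
  then have "inner ?s u = (\<Sum>x\<in>F. (norm (p x u))\<^sup>2)"
    by (simp add: inner_sum_left)
  moreover have "(norm ?s)\<^sup>2 = (\<Sum>x\<in>F. (norm (p x u))\<^sup>2)"
    using norm_sum_p[OF assms, of "\<lambda>_. 1" u] by simp
  moreover have "0 \<le> (norm (u - ?s))\<^sup>2" by simp
  moreover have "(norm (u - ?s))\<^sup>2 = (norm u)\<^sup>2 - 2 * inner ?s u + (norm ?s)\<^sup>2"
    by (simp add: power2_norm_eq_inner inner_diff inner_commute)
  ultimately show ?thesis by linarith
qed

lemma p_sq_summable: "(\<lambda>x. (norm (p x u))\<^sup>2) summable_on A"
  by (rule nonneg_bdd_above_summable_on)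
     (auto intro!: bdd_aboveI2[of _ _ "(norm u)\<^sup>2"] Bessel)

lemma fun_calc_has_sum:
  assumes "u \<in> fun_calc_dom D T f"
  shows "((\<lambda>x. f x *\<^sub>R p x u) has_sum fun_calc D T f u) ev"
  unfolding fun_calc_def
proof (rule has_sum_infsum, rule summable_on_orthogonal[OF pairwise_orthogonal_p])
  show "(\<lambda>x. (norm (f x *\<^sub>R p x u))\<^sup>2) summable_on ev"
    using assms by (simp add: fun_calc_dom_def power_mult_distrib)
qed

lemma p_has_sum_imp:
  assumes "((\<lambda>x. f x *\<^sub>R p x u) has_sum w) ev" "x \<in> ev"
  shows "p x w = f x *\<^sub>R p x u"
proof -
  have "((\<lambda>y. p x (f y *\<^sub>R p y u)) has_sum p x w) ev"
    by (rule has_sum_bounded_linear[OF bounded_linear_p assms(1)])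
  moreover have "((\<lambda>y. p x (f y *\<^sub>R p y u)) has_sum (f x *\<^sub>R p x u)) ev"
    by (rule has_sum_finite_neutralI[of "{x}"]) (simp_all add: assms(2) p_scaleR p_p)
  ultimately show ?thesis by (rule has_sum_unique)
qed

text \<open>The projections sum to some \<open>s\<close> by square summability, and
  \<open>u - s\<close> has zero component in every eigenspace. Completeness of the eigenspaces then
  gives \<open>u = s\<close>.\<close>

lemma spectral_expansion: "((\<lambda>x. p x u) has_sum u) ev"
proof -
  have "u \<in> fun_calc_dom D T (\<lambda>_. 1)" by (simp add: fun_calc_dom_def p_sq_summable)
  from fun_calc_has_sum[OF this] obtain s where s: "((\<lambda>x. 1 *\<^sub>R p x u) has_sum s) ev" ..
  have "cinner w (u - s) = 0" if w: "w \<in> eig x" for x w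
  proof (cases "w = 0")
    case True
    then show ?thesis using cinner_eq_zero_commute[of 0 "u - s"] by simp
  next
    case False
    then have "x \<in> ev" using w by (auto simp: eigenvalues_def)
    then have "p x (u - s) = 0" using p_has_sum_imp[OF s] by (simp add: p_diff)
    then show ?thesis
      using orth_proj_orth[OF closed_csubspace_eigenspace w, of "u - s"] by simp
  qed
  then have "u - s \<in> M" by (simp add: M_def)
  then have "u = s" using eigenspaces_total[of "u - s"] by simp
  with s show ?thesis by simp
qed

lemma eq_if_p_eq:
  assumes "\<And>x. x \<in> ev \<Longrightarrow> p x u = p x v" shows "u = v"
proof (rule has_sum_unique[OF spectral_expansion])
  have "((\<lambda>x. p x u) has_sum v) ev \<longleftrightarrow> ((\<lambda>x. p x v) has_sum v) ev"
    by (rule has_sum_cong) (rule assms)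
  then show "((\<lambda>x. p x u) has_sum v) ev" using spectral_expansion by blast
qed

text \<open>Turns questions about the domain and value of \<open>f(T)\<close> into coordinatewise
  ones. Membership in the domain comes with the coordinates: those of \<open>w\<close> are square
  summable by Bessel's inequality.\<close>

lemma fun_calc_iff:
  "u \<in> fun_calc_dom D T f \<and> fun_calc D T f u = w \<longleftrightarrow> (\<forall>x\<in>ev. p x w = f x *\<^sub>R p x u)"
proof
  assume "u \<in> fun_calc_dom D T f \<and> fun_calc D T f u = w"
  then show "\<forall>x\<in>ev. p x w = f x *\<^sub>R p x u"
    using p_has_sum_imp[OF fun_calc_has_sum] by auto
next
  assume w: "\<forall>x\<in>ev. p x w = f x *\<^sub>R p x u"
  have "(\<lambda>x. (f x * norm (p x u))\<^sup>2) summable_on ev \<longleftrightarrow> (\<lambda>x. (norm (p x w))\<^sup>2) summable_on ev"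
    by (rule summable_on_cong) (simp add: w power_mult_distrib)
  then have dom: "u \<in> fun_calc_dom D T f"
    unfolding fun_calc_dom_def using p_sq_summable by blast
  have "fun_calc D T f u = w"
  proof (rule eq_if_p_eq)
    fix x assume x: "x \<in> ev"
    show "p x (fun_calc D T f u) = p x w"
      using p_has_sum_imp[OF fun_calc_has_sum[OF dom] x] w x by metis
  qed
  with dom show "u \<in> fun_calc_dom D T f \<and> fun_calc D T f u = w" by simp
qed

lemma p_fun_calc: "u \<in> fun_calc_dom D T f \<Longrightarrow> x \<in> ev \<Longrightarrow> p x (fun_calc D T f u) = f x *\<^sub>R p x u"
  using fun_calc_iff by blast

lemma fun_calc_dom_bounded:
  assumes "\<And>x. x \<in> ev \<Longrightarrow> \<bar>f x\<bar> \<le> 1" shows "u \<in> fun_calc_dom D T f"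
  unfolding fun_calc_dom_def mem_Collect_eq
proof (rule summable_on_comparison_test[OF p_sq_summable[of u]])
  fix x assume "x \<in> ev"
  then have "(f x)\<^sup>2 \<le> 1" using assms by (simp add: abs_square_le_1)
  then show "(f x * norm (p x u))\<^sup>2 \<le> (norm (p x u))\<^sup>2"
    by (simp add: power_mult_distrib mult_left_le_one_le)
qed simp

lemma norm_fun_calc_le:
  assumes f: "\<And>x. x \<in> ev \<Longrightarrow> \<bar>f x\<bar> \<le> 1" shows "norm (fun_calc D T f u) \<le> norm u"
proof -
  have "((\<lambda>F. \<Sum>x\<in>F. f x *\<^sub>R p x u) \<longlongrightarrow> fun_calc D T f u) (finite_subsets_at_top ev)"
    using fun_calc_has_sum[OF fun_calc_dom_bounded[OF f]] by (simp add: has_sum_def)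
  then have lim: "((\<lambda>F. norm (\<Sum>x\<in>F. f x *\<^sub>R p x u)) \<longlongrightarrow> norm (fun_calc D T f u)) (finite_subsets_at_top ev)"
    by (rule tendsto_norm)
  have "norm (\<Sum>x\<in>F. f x *\<^sub>R p x u) \<le> norm u" if F: "finite F" "F \<subseteq> ev" for F
  proof -
    have "(norm (\<Sum>x\<in>F. f x *\<^sub>R p x u))\<^sup>2 = (\<Sum>x\<in>F. (f x * norm (p x u))\<^sup>2)"
      by (rule norm_sum_p[OF F(1)])
    also have "\<dots> \<le> (\<Sum>x\<in>F. (norm (p x u))\<^sup>2)"
    proof (rule sum_mono)
      fix x assume "x \<in> F"
      then have "(f x)\<^sup>2 \<le> 1" using f F by (auto simp: abs_square_le_1)
      then show "(f x * norm (p x u))\<^sup>2 \<le> (norm (p x u))\<^sup>2"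
        by (simp add: power_mult_distrib mult_left_le_one_le)
    qed
    also have "\<dots> \<le> (norm u)\<^sup>2" by (rule Bessel[OF F(1)])
    finally show ?thesis by (rule power2_le_imp_le) simp
  qed
  then have "\<forall>\<^sub>F F in finite_subsets_at_top ev. norm (\<Sum>x\<in>F. f x *\<^sub>R p x u) \<le> norm u"
    by (rule eventually_finite_subsets_at_top_weakI)
  with lim show ?thesis by (rule tendsto_upperbound) simp
qed

lemma fun_calc_add:
  assumes "u \<in> fun_calc_dom D T f" "v \<in> fun_calc_dom D T f"
  shows "fun_calc D T f (u + v) = fun_calc D T f u + fun_calc D T f v"
proof -
  have "u + v \<in> fun_calc_dom D T f \<and> fun_calc D T f (u + v) = fun_calc D T f u + fun_calc D T f v"
    unfolding fun_calc_iff by (simp add: p_add p_fun_calc assms scaleR_add_right)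
  then show ?thesis ..
qed

lemma fun_calc_scaleC:
  assumes "u \<in> fun_calc_dom D T f"
  shows "fun_calc D T f (c *\<^sub>C u) = c *\<^sub>C fun_calc D T f u"
proof -
  have "c *\<^sub>C u \<in> fun_calc_dom D T f \<and> fun_calc D T f (c *\<^sub>C u) = c *\<^sub>C fun_calc D T f u"
    unfolding fun_calc_iff by (simp add: p_scaleC p_fun_calc assms scaleC_left_commute_scaleR)
  then show ?thesis ..
qed

lemma bounded_linear_fun_calc:
  assumes "\<And>x. x \<in> ev \<Longrightarrow> \<bar>f x\<bar> \<le> 1" shows "bounded_linear (fun_calc D T f)"
  by (rule bounded_linear_intro[where K = 1])
     (simp_all add: scaleR_scaleC fun_calc_add fun_calc_scaleC fun_calc_dom_bounded assms norm_fun_calc_le)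

section \<open>The scale of spaces and the spectral projections\<close>

abbreviation J :: "real \<Rightarrow> 'a \<Rightarrow> 'a" where
  "J r \<equiv> fun_calc D T (\<lambda>x. (1 + x) powr r)"

text \<open>\<open>L r\<close> is the inverse \<open>(1 + T)\<^sup>-\<^sup>r\<close> of \<open>J r\<close>; for \<open>r \<ge> 0\<close> it is everywhere defined, with range
  the space of order \<open>r\<close>.\<close>
definition L :: "real \<Rightarrow> 'a \<Rightarrow> 'a" where
  "L r = fun_calc D T (\<lambda>x. (1 + x) powr - r)"

lemma powr_neg_le_1: "0 \<le> r \<Longrightarrow> x \<in> ev \<Longrightarrow> \<bar>(1 + x) powr - r\<bar> \<le> 1"
  using powr_mono[of "- r" 0 "1 + x"] eigenvalue_nonneg[of x] by simp

lemma p_L: "0 \<le> r \<Longrightarrow> x \<in> ev \<Longrightarrow> p x (L r w) = (1 + x) powr - r *\<^sub>R p x w"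
  unfolding L_def by (intro p_fun_calc fun_calc_dom_bounded powr_neg_le_1)

lemma powr_cancel: "x \<in> ev \<Longrightarrow> (1 + x) powr r * (1 + x) powr - r = 1"
  using eigenvalue_nonneg[of x] by (simp flip: powr_add)

lemma bounded_linear_L: "0 \<le> r \<Longrightarrow> bounded_linear (L r)"
  unfolding L_def by (intro bounded_linear_fun_calc powr_neg_le_1)

lemma linear_L: "0 \<le> r \<Longrightarrow> linear (L r)"
  by (rule bounded_linear.linear[OF bounded_linear_L])

lemma L_scaleC: "0 \<le> r \<Longrightarrow> L r (c *\<^sub>C u) = c *\<^sub>C L r u"
  unfolding L_def by (intro fun_calc_scaleC fun_calc_dom_bounded powr_neg_le_1)

lemma scale_L:
  assumes "0 \<le> r" shows L_in_scale: "L r w \<in> scale_space D T r" and J_L: "J r (L r w) = w"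
proof -
  have "L r w \<in> fun_calc_dom D T (\<lambda>x. (1 + x) powr r) \<and> J r (L r w) = w"
    unfolding fun_calc_iff
  proof
    fix x assume x: "x \<in> ev"
    show "p x w = (1 + x) powr r *\<^sub>R p x (L r w)"
      by (simp add: p_L[OF assms x] powr_cancel[OF x])
  qed
  then show "L r w \<in> scale_space D T r" "J r (L r w) = w" by (simp_all add: scale_space_def)
qed

lemma L_J:
  assumes "0 \<le> r" "u \<in> scale_space D T r" shows "L r (J r u) = u"
proof (rule eq_if_p_eq)
  fix x assume x: "x \<in> ev"
  have "u \<in> fun_calc_dom D T (\<lambda>x. (1 + x) powr r)" using assms(2) by (simp add: scale_space_def)
  from p_fun_calc[OF this x] show "p x (L r (J r u)) = p x u"
    using powr_cancel[OF x, of r] by (simp add: p_L[OF assms(1) x] mult.commute)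
qed

lemma scale_norm_L: "0 \<le> r \<Longrightarrow> scale_norm D T r (L r w) = norm w"
  by (simp add: scale_norm_def J_L)

lemma bounded_linear_spec_proj: "bounded_linear (spec_proj D T N)"
  unfolding spec_proj_def by (intro bounded_linear_fun_calc) (simp add: indicator_def)

lemma norm_spec_proj_le: "norm (spec_proj D T N u) \<le> norm u"
  unfolding spec_proj_def by (intro norm_fun_calc_le) (simp add: indicator_def)

lemma p_spec_proj: "x \<in> ev \<Longrightarrow> p x (spec_proj D T N u) = indicator {0..N} x *\<^sub>R p x u"
  unfolding spec_proj_def by (intro p_fun_calc fun_calc_dom_bounded) (simp add: indicator_def)

text \<open>Both operators are functions of \<open>T\<close>, so they commute; truncation thus keeps
  its form in coordinates.\<close>

lemma spec_proj_L: "0 \<le> r \<Longrightarrow> spec_proj D T N (L r w) = L r (spec_proj D T N w)"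
  by (rule eq_if_p_eq)
     (simp add: p_spec_proj p_L mult.commute)

text \<open>A finite partial sum of the expansion of \<open>u\<close> is fixed by the projection
  once \<open>N\<close> dominates its finitely many eigenvalues; contractivity controls the
  remainder.\<close>

lemma spec_proj_tendsto: "((\<lambda>N. spec_proj D T N u) \<longlongrightarrow> u) at_top"
proof (rule tendstoI)
  fix e :: real assume "0 < e"
  obtain F where F: "finite F" "F \<subseteq> ev" and approx: "dist (\<Sum>x\<in>F. p x u) u \<le> e / 3"
    using has_sum_finite_approximation[OF spectral_expansion, of "e / 3" u] \<open>0 < e\<close> by auto
  let ?s = "\<Sum>x\<in>F. p x u"
  \<comment> \<open>In the \<open>Max\<close> below, inserting \<open>0\<close> covers the case of
    empty \<open>F\<close>.\<close>
  show "\<forall>\<^sub>F N in at_top. dist (spec_proj D T N u) u < e"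
    using eventually_ge_at_top[of "Max (insert 0 F)"]
  proof eventually_elim
    case (elim N)
    then have N: "x \<le> N" if "x \<in> F" for x using F that by simp
    have lin: "linear (p x)" for x by (rule bounded_linear.linear[OF bounded_linear_p])
    have "spec_proj D T N ?s = ?s"
    proof (rule eq_if_p_eq)
      fix x assume x: "x \<in> ev"
      have "p x ?s = (\<Sum>y\<in>F. if x = y then p x u else 0)"
        by (simp add: linear_sum[OF lin] p_p)
      then have "p x ?s = (if x \<in> F then p x u else 0)" using F by simp
      then show "p x (spec_proj D T N ?s) = p x ?s"
        using N x eigenvalue_nonneg[OF x] by (simp add: p_spec_proj)
    qed
    then have "spec_proj D T N u - ?s = spec_proj D T N (u - ?s)"
      by (simp add: linear_diff[OF bounded_linear.linear[OF bounded_linear_spec_proj]])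
    then have "norm (spec_proj D T N u - ?s) \<le> e / 3"
      using norm_spec_proj_le[of N "u - ?s"] approx by (simp add: dist_norm norm_minus_commute)
    then have "dist (spec_proj D T N u) ?s \<le> e / 3" by (simp add: dist_norm)
    then show ?case using approx dist_triangle[of "spec_proj D T N u" u ?s] \<open>0 < e\<close> by linarith
  qed
qed

end

section \<open>Iterated integrals of bounded operator families\<close>

text \<open>A family \<open>B q \<tau>\<close> plays the role of \<open>A \<tau>\<close> as an operator from the space of order \<open>q + \<mu>\<close>
  to that of order \<open>q\<close>, so consecutive factors of a product have orders shifted by \<open>\<mu>\<close>.\<close>

primrec ordered_prod ::
    "(real \<Rightarrow> real \<Rightarrow> 'a \<Rightarrow>\<^sub>L 'a) \<Rightarrow> real \<Rightarrow> real \<Rightarrow> real list \<Rightarrow> 'a::banach \<Rightarrow> 'a" where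
  "ordered_prod B \<mu> q [] w = w"
| "ordered_prod B \<mu> q (\<tau> # \<tau>s) w = B q \<tau> (ordered_prod B \<mu> (q + \<mu>) \<tau>s w)"

text \<open>The upper limit \<open>s\<close> stays a free argument because the integration variable
  of one level is the upper limit of the next.\<close>

primrec dyson ::
    "(real \<Rightarrow> real \<Rightarrow> 'a \<Rightarrow>\<^sub>L 'a) \<Rightarrow> real \<Rightarrow> nat \<Rightarrow> real \<Rightarrow> 'a::banach \<Rightarrow> real \<Rightarrow> 'a" where
  "dyson B \<mu> 0 q w s = w"
| "dyson B \<mu> (Suc n) q w s = integral {0..s} (\<lambda>\<tau>. B q \<tau> (dyson B \<mu> n (q + \<mu>) w \<tau>))"

text \<open>A block of \<open>n\<close> factors lowers the order by \<open>n * \<mu>\<close>, so the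
  blocks inside it have to end at order \<open>q + n * \<mu>\<close>.\<close>

primrec dyson_comp ::
    "(real \<Rightarrow> real \<Rightarrow> 'a \<Rightarrow>\<^sub>L 'a) \<Rightarrow> real \<Rightarrow> nat list \<Rightarrow> real \<Rightarrow> 'a::banach \<Rightarrow> 'a" where
  "dyson_comp B \<mu> [] q w = w"
| "dyson_comp B \<mu> (n # ns) q w = dyson B \<mu> n q (dyson_comp B \<mu> ns (q + real n * \<mu>) w) 1"

text \<open>Intertwining is available for times in the unit interval only; the ordered simplex never
  leaves \<open>{0..s}\<close>.\<close>

lemma simplex_integral_cong:
  assumes "\<And>\<tau>s. length \<tau>s = n \<Longrightarrow> set \<tau>s \<subseteq> {0..s} \<Longrightarrow> F \<tau>s = G \<tau>s"
  shows "simplex_integral n s F = simplex_integral n s G"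
  using assms
proof (induction n arbitrary: s F G)
  case (Suc n)
  have "simplex_integral n \<tau> (\<lambda>\<tau>s. F (\<tau> # \<tau>s)) = simplex_integral n \<tau> (\<lambda>\<tau>s. G (\<tau> # \<tau>s))"
    if "\<tau> \<in> {0..s}" for \<tau>
    by (rule Suc.IH) (use that in \<open>auto intro!: Suc.prems\<close>)
  then show ?case by (auto intro: integral_cong)
qed simp

context
  fixes B :: "real \<Rightarrow> real \<Rightarrow> 'a \<Rightarrow>\<^sub>L 'a::banach" and \<mu> :: real
  assumes \<mu>: "0 \<le> \<mu>" and cont: "\<And>q. 0 \<le> q \<Longrightarrow> continuous_on {0..1} (B q)"
begin

lemma continuous_on_dyson:
  assumes "0 \<le> q" shows "continuous_on {0..1} (dyson B \<mu> n q w)"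
  using assms
proof (induction n arbitrary: q)
  case (Suc n)
  have "continuous_on {0..1} (dyson B \<mu> n (q + \<mu>) w)"
    using Suc \<mu> by simp
  then have "(\<lambda>\<tau>. B q \<tau> (dyson B \<mu> n (q + \<mu>) w \<tau>)) integrable_on {0..1}"
    using cont[OF Suc.prems]
    by (intro integrable_continuous_interval continuous_intros)
  then show ?case
    by (simp add: indefinite_integral_continuous_1)
qed simp

lemma continuous_on_dyson_integrand:
  assumes "0 \<le> q" shows "continuous_on {0..1} (\<lambda>\<tau>. B q \<tau> (dyson B \<mu> n (q + \<mu>) w \<tau>))"
  using assms cont[OF assms] continuous_on_dyson[of "q + \<mu>" n w] \<mu>
  by (intro continuous_intros) auto

text \<open>The general \<open>F\<close> carries the outer factors already applied, which makes the
  induction close; continuity of the integrand lets \<open>F\<close> pass through the integral. With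
  \<open>F = L q\<close> this is the passage to coordinates.\<close>

lemma simplex_integral_ordered_prod:
  assumes "bounded_linear F" "0 \<le> q" "s \<in> {0..1}"
  shows "simplex_integral n s (\<lambda>\<tau>s. F (ordered_prod B \<mu> q \<tau>s w)) = F (dyson B \<mu> n q w s)"
  using assms
proof (induction n arbitrary: F q s)
  case (Suc n)
  let ?g = "\<lambda>\<tau>. B q \<tau> (dyson B \<mu> n (q + \<mu>) w \<tau>)"
  have "simplex_integral (Suc n) s (\<lambda>\<tau>s. F (ordered_prod B \<mu> q \<tau>s w))
      = integral {0..s} (\<lambda>\<tau>. F (?g \<tau>))"
  proof (simp, rule integral_cong)
    fix \<tau> assume "\<tau> \<in> {0..s}"
    have "bounded_linear (\<lambda>x. F (B q \<tau> x))"
      by (rule bounded_linear_compose[OF Suc.prems(1) blinfun.bounded_linear_right])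
    then show "simplex_integral n \<tau> (\<lambda>\<tau>s. F (B q \<tau> (ordered_prod B \<mu> (q + \<mu>) \<tau>s w))) = F (?g \<tau>)"
      using Suc.prems \<mu> \<open>\<tau> \<in> {0..s}\<close> by (intro Suc.IH) auto
  qed
  also have "\<dots> = F (integral {0..s} ?g)"
  proof -
    have "?g integrable_on {0..s}"
      using continuous_on_subset[OF continuous_on_dyson_integrand[OF Suc.prems(2)]] Suc.prems(3)
      by (intro integrable_continuous_interval) auto
    from integral_linear[OF this Suc.prems(1)] show ?thesis by (simp add: comp_def)
  qed
  finally show ?case by simp
qed simp

section \<open>Strongly convergent contractions and compressions\<close>

context
  fixes P :: "real \<Rightarrow> 'a \<Rightarrow>\<^sub>L 'a"
  assumes P_le: "\<And>N v. norm (P N v) \<le> norm v"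
    and P_lim: "\<And>v. ((\<lambda>N. P N v) \<longlongrightarrow> v) at_top"
begin

text \<open>Strong convergence of contractions is uniform on compact sets: the image of
  \<open>g\<close> is covered by finitely many small balls, and convergence is checked at their
  centres.\<close>

lemma uniform_limit_strong:
  assumes g: "continuous_on S g" and "compact S"
  shows "uniform_limit S (\<lambda>N \<tau>. P N (g \<tau>)) g at_top"
proof (rule uniform_limitI)
  fix e :: real assume "0 < e"
  have "compact (g ` S)" using assms by (rule compact_continuous_image)
  then have "\<exists>k. finite k \<and> g ` S \<subseteq> (\<Union>x\<in>k. ball x (e / 3))"
    unfolding compact_eq_totally_bounded using \<open>0 < e\<close> by simp
  then obtain k where k: "finite k" and cover: "g ` S \<subseteq> (\<Union>x\<in>k. ball x (e / 3))"
    by blast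
  have "\<forall>\<^sub>F N in at_top. \<forall>x\<in>k. dist (P N x) x < e / 3"
    using k \<open>0 < e\<close> by (intro eventually_ball_finite ballI tendstoD[OF P_lim]) auto
  then show "\<forall>\<^sub>F N in at_top. \<forall>\<tau>\<in>S. dist (P N (g \<tau>)) (g \<tau>) < e"
  proof eventually_elim
    case (elim N)
    show ?case
    proof
      fix \<tau> assume "\<tau> \<in> S"
      then obtain x where x: "x \<in> k" "dist x (g \<tau>) < e / 3" using cover by fastforce
      have "dist (P N (g \<tau>)) (P N x) = norm (P N (g \<tau> - x))"
        by (simp add: dist_norm blinfun.diff_right)
      also have "\<dots> \<le> norm (g \<tau> - x)" by (rule P_le)
      finally have "dist (P N (g \<tau>)) (P N x) < e / 3" using x by (simp add: dist_norm norm_minus_commute)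
      moreover have "dist (P N x) x < e / 3" using elim x by blast
      moreover have "dist (P N (g \<tau>)) (g \<tau>)
          \<le> dist (P N (g \<tau>)) (P N x) + (dist (P N x) x + dist x (g \<tau>))"
        by (meson add_left_mono dist_triangle order_trans)
      ultimately show "dist (P N (g \<tau>)) (g \<tau>) < e" using x by linarith
    qed
  qed
qed

lemma uniform_limit_contraction:
  assumes "uniform_limit S f g at_top"
  shows "uniform_limit S (\<lambda>N \<tau>. P N (f N \<tau> - g \<tau>)) (\<lambda>_. 0) at_top"
proof (rule uniform_limitI)
  fix e :: real assume "0 < e"
  with assms have "\<forall>\<^sub>F N in at_top. \<forall>\<tau>\<in>S. dist (f N \<tau>) (g \<tau>) < e" by (rule uniform_limitD)
  then show "\<forall>\<^sub>F N in at_top. \<forall>\<tau>\<in>S. dist (P N (f N \<tau> - g \<tau>)) 0 < e"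
    by eventually_elim (auto simp: dist_norm intro: le_less_trans[OF P_le])
qed

text \<open>Split \<open>P N (f N \<tau>) - g \<tau>\<close> into
  \<open>P N (f N \<tau> - g \<tau>)\<close> and \<open>P N (g \<tau>) - g \<tau>\<close>.\<close>

lemma uniform_limit_strong':
  assumes f: "uniform_limit S f g at_top" and g: "continuous_on S g" and S: "compact S"
  shows "uniform_limit S (\<lambda>N \<tau>. P N (f N \<tau>)) g at_top"
  using uniform_limit_add[OF uniform_limit_contraction[OF f] uniform_limit_strong[OF g S]]
  by (simp add: blinfun.diff_right)

abbreviation BP :: "real \<Rightarrow> real \<Rightarrow> real \<Rightarrow> 'a \<Rightarrow>\<^sub>L 'a" where
  "BP N q \<tau> \<equiv> P N o\<^sub>L B q \<tau> o\<^sub>L P N"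

text \<open>The compressions need not converge in norm, so convergence is followed along the
  vectors, applying \<open>P N\<close>, \<open>B q \<tau>\<close> and \<open>P N\<close> in turn.
  The middle step uses that \<open>B q\<close> and \<open>g\<close> are bounded on the compact
  interval.\<close>

lemma uniform_limit_compression:
  assumes q: "0 \<le> q" and f: "uniform_limit {0..1} f g at_top" and g: "continuous_on {0..1} g"
  shows "uniform_limit {0..1} (\<lambda>N \<tau>. BP N q \<tau> (f N \<tau>)) (\<lambda>\<tau>. B q \<tau> (g \<tau>)) at_top"
proof -
  have "bounded (B q ` {0..1})"
    using compact_continuous_image[OF cont[OF q]] compact_imp_bounded by blast
  moreover have "bounded (g ` {0..1})"
    using compact_continuous_image[OF g] compact_imp_bounded by blast
  ultimately have "uniform_limit {0..1} (\<lambda>N \<tau>. B q \<tau> (P N (f N \<tau>))) (\<lambda>\<tau>. B q \<tau> (g \<tau>)) at_top"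
    using uniform_limit_strong'[OF f g compact_Icc]
    by (intro bounded_bilinear.bounded_uniform_limit[OF bounded_bilinear_blinfun_apply]
        uniform_limit_const) auto
  then have "uniform_limit {0..1} (\<lambda>N \<tau>. P N (B q \<tau> (P N (f N \<tau>)))) (\<lambda>\<tau>. B q \<tau> (g \<tau>)) at_top"
    by (rule uniform_limit_strong') (use cont[OF q] g in \<open>auto intro: continuous_intros\<close>)
  then show ?thesis by simp
qed

end
end

lemma uniform_limit_indefinite_integral:
  fixes f :: "'i \<Rightarrow> real \<Rightarrow> 'a::banach"
  assumes f: "uniform_limit {0..1} f g F"
    and cf: "\<And>n. continuous_on {0..1} (f n)" and cg: "continuous_on {0..1} g"
  shows "uniform_limit {0..1} (\<lambda>n s. integral {0..s} (f n)) (\<lambda>s. integral {0..s} g) F"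
proof (rule uniform_limitI)
  fix e :: real assume "0 < e"
  then have "\<forall>\<^sub>F n in F. \<forall>\<tau>\<in>{0..1}. dist (f n \<tau>) (g \<tau>) < e / 2"
    by (intro uniform_limitD[OF f]) simp
  then show "\<forall>\<^sub>F n in F. \<forall>s\<in>{0..1}. dist (integral {0..s} (f n)) (integral {0..s} g) < e"
  proof eventually_elim
    case (elim n)
    show ?case
    proof
      fix s :: real assume s: "s \<in> {0..1}"
      have c: "continuous_on {0..s} (f n)" "continuous_on {0..s} g"
        using continuous_on_subset[OF cf, of "{0..s}" n] continuous_on_subset[OF cg, of "{0..s}"] s
        by auto
      have "norm (integral {0..s} (\<lambda>\<tau>. f n \<tau> - g \<tau>)) \<le> e / 2 * (s - 0)"
      proof (rule integral_bound)
        show "continuous_on {0..s} (\<lambda>\<tau>. f n \<tau> - g \<tau>)" by (intro continuous_on_diff c)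
        show "norm (f n \<tau> - g \<tau>) \<le> e / 2" if "\<tau> \<in> {0..s}" for \<tau>
          using elim that s by (auto simp: dist_norm intro: less_imp_le)
      qed (use s in simp)
      also have "\<dots> \<le> e / 2" using s \<open>0 < e\<close> by simp
      also have "integral {0..s} (\<lambda>\<tau>. f n \<tau> - g \<tau>) = integral {0..s} (f n) - integral {0..s} g"
        using c by (intro integral_diff integrable_continuous_interval)
      finally show "dist (integral {0..s} (f n)) (integral {0..s} g) < e"
        using \<open>0 < e\<close> by (simp add: dist_norm)
    qed
  qed
qed

text \<open>Convergence must be uniform in the upper limit, which becomes an integration variable
  one level up. The starting vectors vary with \<open>N\<close> because in a composition they come
  from truncated inner blocks.\<close>

lemma uniform_limit_dyson:
  fixes B :: "real \<Rightarrow> real \<Rightarrow> 'a \<Rightarrow>\<^sub>L 'a::banach" and P :: "real \<Rightarrow> 'a \<Rightarrow>\<^sub>L 'a"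
  assumes \<mu>: "0 \<le> \<mu>" and cont: "\<And>q. 0 \<le> q \<Longrightarrow> continuous_on {0..1} (B q)"
    and P_le: "\<And>N v. norm (P N v) \<le> norm v"
    and P_lim: "\<And>v. ((\<lambda>N. P N v) \<longlongrightarrow> v) at_top"
    and w: "(w \<longlongrightarrow> w0) at_top" and q: "0 \<le> q"
  shows "uniform_limit {0..1} (\<lambda>N. dyson (\<lambda>q \<tau>. P N o\<^sub>L B q \<tau> o\<^sub>L P N) \<mu> n q (w N))
    (dyson B \<mu> n q w0) at_top"
  using q
proof (induction n arbitrary: q)
  case 0
  show ?case
  proof (rule uniform_limitI)
    fix e :: real assume "0 < e"
    with w have "\<forall>\<^sub>F N in at_top. dist (w N) w0 < e" by (rule tendstoD)
    then show "\<forall>\<^sub>F N in at_top. \<forall>s\<in>{0..1}.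
        dist (dyson (\<lambda>q \<tau>. P N o\<^sub>L B q \<tau> o\<^sub>L P N) \<mu> 0 q (w N) s) (dyson B \<mu> 0 q w0 s) < e"
      by eventually_elim simp
  qed
next
  case (Suc n)
  let ?BP = "\<lambda>N q \<tau>. P N o\<^sub>L B q \<tau> o\<^sub>L P N"
  have q: "0 \<le> q" "0 \<le> q + \<mu>" using Suc.prems \<mu> by simp_all
  have cP: "continuous_on {0..1} (?BP N q)" if "0 \<le> q" for N q
    using cont that by (intro continuous_intros) auto
  have "uniform_limit {0..1} (\<lambda>N \<tau>. ?BP N q \<tau> (dyson (?BP N) \<mu> n (q + \<mu>) (w N) \<tau>))
      (\<lambda>\<tau>. B q \<tau> (dyson B \<mu> n (q + \<mu>) w0 \<tau>)) at_top"
    by (rule uniform_limit_compression[OF \<mu> cont P_le P_lim q(1) Suc.IH[OF q(2)]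
          continuous_on_dyson[OF \<mu> cont q(2)]])
  moreover have "continuous_on {0..1} (\<lambda>\<tau>. ?BP N q \<tau> (dyson (?BP N) \<mu> n (q + \<mu>) (w N) \<tau>))" for N
    by (rule continuous_on_dyson_integrand[OF \<mu> cP q(1)])
  moreover have "continuous_on {0..1} (\<lambda>\<tau>. B q \<tau> (dyson B \<mu> n (q + \<mu>) w0 \<tau>))"
    by (rule continuous_on_dyson_integrand[OF \<mu> cont q(1)])
  ultimately have "uniform_limit {0..1}
      (\<lambda>N s. integral {0..s} (\<lambda>\<tau>. ?BP N q \<tau> (dyson (?BP N) \<mu> n (q + \<mu>) (w N) \<tau>)))
      (\<lambda>s. integral {0..s} (\<lambda>\<tau>. B q \<tau> (dyson B \<mu> n (q + \<mu>) w0 \<tau>))) at_top"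
    by (rule uniform_limit_indefinite_integral)
  then show ?case by simp
qed

lemma tendsto_dyson_comp:
  fixes B :: "real \<Rightarrow> real \<Rightarrow> 'a \<Rightarrow>\<^sub>L 'a::banach" and P :: "real \<Rightarrow> 'a \<Rightarrow>\<^sub>L 'a"
  assumes \<mu>: "0 \<le> \<mu>" and cont: "\<And>q. 0 \<le> q \<Longrightarrow> continuous_on {0..1} (B q)"
    and P_le: "\<And>N v. norm (P N v) \<le> norm v"
    and P_lim: "\<And>v. ((\<lambda>N. P N v) \<longlongrightarrow> v) at_top"
    and w: "(w \<longlongrightarrow> w0) at_top" and q: "0 \<le> q"
  shows "((\<lambda>N. dyson_comp (\<lambda>q \<tau>. P N o\<^sub>L B q \<tau> o\<^sub>L P N) \<mu> ns q (w N)) \<longlongrightarrow>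
    dyson_comp B \<mu> ns q w0) at_top"
  using q
proof (induction ns arbitrary: q)
  case Nil
  then show ?case using w by simp
next
  case (Cons n ns)
  have "0 \<le> q + real n * \<mu>" using Cons.prems \<mu> by simp
  from uniform_limit_dyson[OF \<mu> cont P_le P_lim Cons.IH[OF this] Cons.prems, where n = n]
  have "uniform_limit {0..1}
      (\<lambda>N. dyson (\<lambda>q \<tau>. P N o\<^sub>L B q \<tau> o\<^sub>L P N) \<mu> n q
        (dyson_comp (\<lambda>q \<tau>. P N o\<^sub>L B q \<tau> o\<^sub>L P N) \<mu> ns (q + real n * \<mu>) (w N)))
      (dyson B \<mu> n q (dyson_comp B \<mu> ns (q + real n * \<mu>) w0)) at_top" .
  from tendsto_uniform_limitI[OF this, of 1] show ?case by simp
qed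

section \<open>Magnus coefficients in coordinates\<close>

definition magnus_coords ::
    "(real \<Rightarrow> real \<Rightarrow> 'a \<Rightarrow>\<^sub>L 'a) \<Rightarrow> real \<Rightarrow> nat \<Rightarrow> real \<Rightarrow> 'a::complex_hilbert \<Rightarrow> 'a" where
  "magnus_coords B \<mu> l q w =
     (\<i> * (- \<i>) ^ (l + 1)) *\<^sub>C
       (\<Sum>k = 1..l + 1. ((- 1) ^ (k - 1) / of_nat k) *\<^sub>C
          (\<Sum>ns\<in>compositions (l + 1) k. dyson_comp B \<mu> ns q w))"

context pos_selfadjoint
begin

text \<open>\<open>B q t\<close> is \<open>A t\<close>, from the space of order \<open>q + \<mu>\<close> to that of order \<open>q\<close>, transported to
  the Hilbert space by \<open>L\<close>.\<close>
definition intertwined :: "real \<Rightarrow> (real \<Rightarrow> 'a \<Rightarrow> 'a) \<Rightarrow> (real \<Rightarrow> real \<Rightarrow> 'a \<Rightarrow>\<^sub>L 'a) \<Rightarrow> bool" where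
  "intertwined \<mu> A B \<longleftrightarrow> (\<forall>q\<ge>0. \<forall>t\<in>{0..1}. \<forall>w. A t (L (q + \<mu>) w) = L q (B q t w))"

context
  fixes \<mu> :: real and A :: "real \<Rightarrow> 'a \<Rightarrow> 'a" and B :: "real \<Rightarrow> real \<Rightarrow> 'a \<Rightarrow>\<^sub>L 'a"
  assumes \<mu>: "0 \<le> \<mu>" and cont: "\<And>q. 0 \<le> q \<Longrightarrow> continuous_on {0..1} (B q)"
    and AB: "intertwined \<mu> A B"
begin

text \<open>Each factor lowers the order by \<mu>, so \<open>L\<close> moves outward through the
  product and loses \<mu> at every step.\<close>

lemma foldr_intertwined:
  assumes "0 \<le> q" "set \<tau>s \<subseteq> {0..1}"
  shows "foldr A \<tau>s (L (q + real (length \<tau>s) * \<mu>) w) = L q (ordered_prod B \<mu> q \<tau>s w)"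
  using assms
proof (induction \<tau>s arbitrary: q)
  case (Cons \<tau> \<tau>s)
  have shift: "q + real (length (\<tau> # \<tau>s)) * \<mu> = q + \<mu> + real (length \<tau>s) * \<mu>"
    by (simp add: algebra_simps)
  have "foldr A (\<tau> # \<tau>s) (L (q + real (length (\<tau> # \<tau>s)) * \<mu>) w)
      = A \<tau> (L (q + \<mu>) (ordered_prod B \<mu> (q + \<mu>) \<tau>s w))"
    unfolding shift using Cons.IH[of "q + \<mu>"] Cons.prems \<mu> by simp
  also have "\<dots> = L q (ordered_prod B \<mu> q (\<tau> # \<tau>s) w)"
    using AB Cons.prems by (simp add: intertwined_def)
  finally show ?case .
qed simp

text \<open>The integral in \<open>magnus_D\<close> is taken in the norm of the Hilbert space;
  pulling the bounded operator \<open>L q\<close> out of it places the value in the space of order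
  \<open>q\<close>.\<close>

lemma magnus_D_intertwined:
  assumes "0 \<le> q"
  shows "magnus_D A n (L (q + real n * \<mu>) w) = L q (dyson B \<mu> n q w 1)"
proof -
  have "magnus_D A n (L (q + real n * \<mu>) w)
      = simplex_integral n 1 (\<lambda>\<tau>s. L q (ordered_prod B \<mu> q \<tau>s w))"
    unfolding magnus_D_def
    by (rule simplex_integral_cong) (use foldr_intertwined[OF assms] in force)
  also have "\<dots> = L q (dyson B \<mu> n q w 1)"
    by (rule simplex_integral_ordered_prod[OF \<mu> cont bounded_linear_L[OF assms] assms]) simp_all
  finally show ?thesis .
qed

lemma foldr_magnus_D_intertwined:
  assumes "0 \<le> q"
  shows "foldr (magnus_D A) ns (L (q + real (sum_list ns) * \<mu>) w) = L q (dyson_comp B \<mu> ns q w)"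
  using assms
proof (induction ns arbitrary: q)
  case (Cons n ns)
  have shift: "q + real (sum_list (n # ns)) * \<mu> = q + real n * \<mu> + real (sum_list ns) * \<mu>"
    by (simp add: algebra_simps)
  show ?case
    unfolding shift using Cons.IH[of "q + real n * \<mu>"] Cons.prems \<mu> by (simp add: magnus_D_intertwined)
qed simp

text \<open>Every composition has total \<open>l + 1\<close>, so all terms of the coefficient share
  one starting order.\<close>

lemma magnus_FM_intertwined:
  assumes q: "0 \<le> q"
  shows "magnus_FM l A (L (q + (real l + 1) * \<mu>) w) = L q (magnus_coords B \<mu> l q w)"
proof -
  have "(\<Sum>ns\<in>compositions (l + 1) k. foldr (magnus_D A) ns (L (q + (real l + 1) * \<mu>) w))
      = L q (\<Sum>ns\<in>compositions (l + 1) k. dyson_comp B \<mu> ns q w)" for k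
    unfolding linear_sum[OF linear_L[OF q]]
  proof (rule sum.cong[OF refl])
    fix ns assume "ns \<in> compositions (l + 1) k"
    then have "real (sum_list ns) = real l + 1" by (simp add: compositions_def)
    with foldr_magnus_D_intertwined[OF q, of ns w]
    show "foldr (magnus_D A) ns (L (q + (real l + 1) * \<mu>) w) = L q (dyson_comp B \<mu> ns q w)" by simp
  qed
  then show ?thesis
    unfolding magnus_FM_def magnus_coords_def
    by (simp only: L_scaleC[OF q, symmetric] linear_sum[OF linear_L[OF q], symmetric])
qed

end

text \<open>Conjugation by the isometries between the scale and the Hilbert space turns boundedness
  in the scale into boundedness of \<open>B q t\<close>, and the operator norm in the scale
  dominates that of the differences.\<close>

lemma exists_intertwined:
  assumes \<mu>: "0 \<le> \<mu>"
    and add: "\<And>s t u v. 0 \<le> s \<Longrightarrow> u \<in> scale_space D T (s + \<mu>) \<Longrightarrow> v \<in> scale_space D T (s + \<mu>)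
      \<Longrightarrow> A t (u + v) = A t u + A t v"
    and scale: "\<And>s t u c. 0 \<le> s \<Longrightarrow> u \<in> scale_space D T (s + \<mu>)
      \<Longrightarrow> A t (c *\<^sub>C u) = c *\<^sub>C A t u"
    and bounded: "\<And>s t. 0 \<le> s \<Longrightarrow> scale_bounded D T (s + \<mu>) s (A t)"
    and cont: "\<And>s t0. 0 \<le> s \<Longrightarrow> t0 \<in> {0..1} \<Longrightarrow>
      ((\<lambda>t. scale_onorm D T (s + \<mu>) s (\<lambda>v. A t v - A t0 v)) \<longlongrightarrow> 0) (at t0 within {0..1})"
  shows "\<exists>B. intertwined \<mu> A B \<and> (\<forall>q\<ge>0. continuous_on {0..1} (B q))"
proof -
  \<comment> \<open>\<open>Blinfun\<close> is meaningful here for nonnegative \<open>q\<close>,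
    where the conjugated operator is shown to be bounded linear.\<close>
  define B where "B q t = Blinfun (\<lambda>w. J q (A t (L (q + \<mu>) w)))" for q t
  have mem: "A t (L (q + \<mu>) w) \<in> scale_space D T q" if "0 \<le> q" for q t w
    using bounded[OF that, of t] L_in_scale[of "q + \<mu>" w] that \<mu>
    unfolding scale_bounded_def by auto
  have B_apply: "B q t w = J q (A t (L (q + \<mu>) w))" if q: "0 \<le> q" for q t w
  proof -
    have q\<mu>: "0 \<le> q + \<mu>" using q \<mu> by simp
    obtain C where C: "\<And>u. u \<in> scale_space D T (q + \<mu>) \<Longrightarrow>
        scale_norm D T q (A t u) \<le> C * scale_norm D T (q + \<mu>) u"
      using bounded[OF q, of t] unfolding scale_bounded_def by blast
    have "bounded_linear (\<lambda>w. J q (A t (L (q + \<mu>) w)))"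
    proof (rule bounded_linear_intro[where K = C])
      note dom = mem[OF q, unfolded scale_space_def]
      show "J q (A t (L (q + \<mu>) (v + w))) = J q (A t (L (q + \<mu>) v)) + J q (A t (L (q + \<mu>) w))" for v w
        by (simp add: linear_add[OF linear_L[OF q\<mu>]] add[OF q L_in_scale[OF q\<mu>] L_in_scale[OF q\<mu>]]
            fun_calc_add[OF dom dom])
      show "J q (A t (L (q + \<mu>) (c *\<^sub>R w))) = c *\<^sub>R J q (A t (L (q + \<mu>) w))" for c w
        by (simp add: scaleR_scaleC L_scaleC[OF q\<mu>] scale[OF q L_in_scale[OF q\<mu>]]
            fun_calc_scaleC[OF dom])
      show "norm (J q (A t (L (q + \<mu>) w))) \<le> norm w * C" for w
        using C[OF L_in_scale[OF q\<mu>], of w]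
        by (simp add: scale_norm_L[OF q\<mu>] mult.commute) (simp add: scale_norm_def)
    qed
    then show ?thesis by (simp add: B_def bounded_linear_Blinfun_apply)
  qed
  have "A t (L (q + \<mu>) w) = L q (B q t w)" if "0 \<le> q" for q t w
    using that by (simp add: B_apply L_J mem)
  then have tw: "intertwined \<mu> A B" by (simp add: intertwined_def)
  moreover have "continuous_on {0..1} (B q)" if q: "0 \<le> q" for q
    unfolding continuous_on_def
  proof
    fix t0 :: real assume t0: "t0 \<in> {0..1}"
    let ?on = "\<lambda>t. scale_onorm D T (q + \<mu>) q (\<lambda>v. A t v - A t0 v)"
    have q\<mu>: "0 \<le> q + \<mu>" using q \<mu> by simp
    have "norm (B q t - B q t0) \<le> ?on t" if t: "t \<in> {0..1}" for t
    proof -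
      let ?ratio = "\<lambda>u. scale_norm D T q (A t u - A t0 u) / scale_norm D T (q + \<mu>) u"
      have ratio: "?ratio (L (q + \<mu>) w) = norm ((B q t - B q t0) w) / norm w" for w
      proof -
        have "A t (L (q + \<mu>) w) - A t0 (L (q + \<mu>) w) = L q ((B q t - B q t0) w)"
          using tw q t t0
          by (simp add: intertwined_def blinfun.diff_left
              linear_diff[OF linear_L[OF q]])
        then show ?thesis by (simp add: scale_norm_L q q\<mu>)
      qed
      \<comment> \<open>The real supremum in \<open>scale_onorm\<close> is sure to dominate its
        entries only once they are known to be bounded.\<close>
      have bdd: "bdd_above (?ratio ` scale_space D T (q + \<mu>))"
      proof (rule bdd_aboveI2)
        fix u assume "u \<in> scale_space D T (q + \<mu>)"
        then have "u = L (q + \<mu>) (J (q + \<mu>) u)" by (simp add: L_J q\<mu>)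
        then have "?ratio u = norm ((B q t - B q t0) (J (q + \<mu>) u)) / norm (J (q + \<mu>) u)"
          using ratio by metis
        also have "\<dots> \<le> norm (B q t - B q t0)"
          using norm_blinfun[of "B q t - B q t0" "J (q + \<mu>) u"]
          by (cases "J (q + \<mu>) u = 0") (simp_all add: divide_le_eq)
        finally show "?ratio u \<le> norm (B q t - B q t0)" .
      qed
      have le: "norm ((B q t - B q t0) w) / norm w \<le> ?on t" for w
        unfolding scale_onorm_def ratio[symmetric]
        by (rule cSUP_upper[OF L_in_scale[OF q\<mu>] bdd])
      show ?thesis
      proof (rule norm_blinfun_bound)
        \<comment> \<open>At the zero vector the quotient is \<open>0 / 0 = 0\<close>, so the
          supremum is nonnegative.\<close>
        show "0 \<le> ?on t" using le[of 0] by simp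
        show "norm ((B q t - B q t0) w) \<le> ?on t * norm w" for w
          using le[of w] by (cases "w = 0") (simp_all add: divide_le_eq)
      qed
    qed
    then have "\<forall>\<^sub>F t in at t0 within {0..1}. norm (B q t - B q t0) \<le> ?on t"
      by (simp add: eventually_at_filter)
    from Lim_null_comparison[OF this cont[OF q t0]] show "(B q \<longlongrightarrow> B q t0) (at t0 within {0..1})"
      by (rule LIM_zero_cancel)
  qed
  ultimately show ?thesis by blast
qed

lemma intertwined_truncated:
  assumes "0 \<le> \<mu>" and AB: "intertwined \<mu> A B"
  shows "intertwined \<mu> (truncated D T A N)
    (\<lambda>q \<tau>. Blinfun (spec_proj D T N) o\<^sub>L B q \<tau> o\<^sub>L Blinfun (spec_proj D T N))"
  using assms
  by (simp add: intertwined_def truncated_def spec_proj_L bounded_linear_Blinfun_apply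
      bounded_linear_spec_proj)

end

section \<open>Convergence of the truncated Floquet-Magnus coefficients\<close>

theorem proposition4p4:
  fixes D0 :: "'a::complex_hilbert set" and H0 :: "'a \<Rightarrow> 'a"
    and DH :: "real \<Rightarrow> 'a set" and H :: "real \<Rightarrow> 'a \<Rightarrow> 'a"
    and \<mu> r :: real and l :: nat and u :: 'a
  assumes separable: "\<exists>S::'a set. countable S \<and> closure S = UNIV"
    and H0_selfadjoint: "selfadjoint_operator D0 H0"
    and H0_positive: "positive_operator D0 H0"
    and H0_compact_resolvent: "has_compact_resolvent D0 H0"
    and mu_nonneg: "0 \<le> \<mu>"
    and H_periodic: "\<And>t. DH (t + 1) = DH t" "\<And>t v. v \<in> DH t \<Longrightarrow> H (t + 1) v = H t v"
    and H_symmetric: "\<And>t. symmetric_operator (DH t) (H t)"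
    and H_domain: "\<And>s t. 0 \<le> s \<Longrightarrow> scale_space D0 H0 (s + \<mu>) \<subseteq> DH t"
    and H_bounded: "\<And>s t. 0 \<le> s \<Longrightarrow> scale_bounded D0 H0 (s + \<mu>) s (H t)"
    and H_continuous: "\<And>s t0. 0 \<le> s \<Longrightarrow> t0 \<in> {0..1} \<Longrightarrow>
      ((\<lambda>t. scale_onorm D0 H0 (s + \<mu>) s (\<lambda>v. H t v - H t0 v)) \<longlongrightarrow> 0) (at t0 within {0..1})"
    and r_nonneg: "0 \<le> r"
    and u_in: "u \<in> scale_space D0 H0 (r + (real l + 1) * \<mu>)"
  shows "magnus_FM l H u \<in> scale_space D0 H0 r \<and>
    (\<forall>N>0. magnus_FM l (truncated D0 H0 H N) (spec_proj D0 H0 N u) \<in> scale_space D0 H0 r) \<and>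
    ((\<lambda>N. scale_norm D0 H0 r
        (magnus_FM l (truncated D0 H0 H N) (spec_proj D0 H0 N u) - magnus_FM l H u)) \<longlongrightarrow> 0) at_top"
proof -
  interpret pos_selfadjoint D0 H0
    by unfold_locales (rule H0_selfadjoint H0_positive H0_compact_resolvent)+
  have lin: "linear_operator (DH t) (H t)" for t
    using H_symmetric[of t] by (simp add: symmetric_operator_def densely_defined_operator_def)
  have "\<exists>B. intertwined \<mu> H B \<and> (\<forall>q\<ge>0. continuous_on {0..1} (B q))"
  proof (rule exists_intertwined[OF mu_nonneg _ _ H_bounded H_continuous])
    fix s t v v' assume "0 \<le> s" "v \<in> scale_space D0 H0 (s + \<mu>)" "v' \<in> scale_space D0 H0 (s + \<mu>)"
    then have "v \<in> DH t" "v' \<in> DH t" using H_domain[of s t] by auto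
    then show "H t (v + v') = H t v + H t v'" using lin[of t] by (simp add: linear_operator_def)
  next
    fix s t v c assume "0 \<le> s" "v \<in> scale_space D0 H0 (s + \<mu>)"
    then have "v \<in> DH t" using H_domain[of s t] by auto
    then show "H t (c *\<^sub>C v) = c *\<^sub>C H t v" using lin[of t] by (simp add: linear_operator_def)
  qed
  then obtain B where HB: "intertwined \<mu> H B" and cont: "\<And>q. 0 \<le> q \<Longrightarrow> continuous_on {0..1} (B q)"
    by blast
  define P where "P N = Blinfun (spec_proj D0 H0 N)" for N
  have P_apply: "P N v = spec_proj D0 H0 N v" for N v
    by (simp add: P_def bounded_linear_Blinfun_apply bounded_linear_spec_proj)
  have P_le: "norm (P N v) \<le> norm v" for N v by (simp add: P_apply norm_spec_proj_le)
  have P_lim: "((\<lambda>N. P N v) \<longlongrightarrow> v) at_top" for v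
    by (simp add: P_apply spec_proj_tendsto)
  define BP where "BP N = (\<lambda>q \<tau>. P N o\<^sub>L B q \<tau> o\<^sub>L P N)" for N
  have BP: "intertwined \<mu> (truncated D0 H0 H N) (BP N)" for N
    unfolding BP_def P_def by (rule intertwined_truncated[OF mu_nonneg HB])
  have cont_BP: "continuous_on {0..1} (BP N q)" if "0 \<le> q" for N q
    unfolding BP_def using cont[OF that] by (intro continuous_intros)
  define m where "m = r + (real l + 1) * \<mu>"
  have m: "0 \<le> m" using r_nonneg mu_nonneg by (simp add: m_def)
  define w where "w = J m u"
  have u: "u = L m w" using u_in by (simp add: w_def L_J m flip: m_def)
  have FM: "magnus_FM l H u = L r (magnus_coords B \<mu> l r w)"
    unfolding u m_def by (rule magnus_FM_intertwined[OF mu_nonneg cont HB r_nonneg])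
  \<comment> \<open>\<open>spec_proj\<close> commutes with \<open>L m\<close>, so the truncated
    vector has coordinate \<open>P N w\<close>.\<close>
  have FM_N: "magnus_FM l (truncated D0 H0 H N) (spec_proj D0 H0 N u)
      = L r (magnus_coords (BP N) \<mu> l r (P N w))" for N
    unfolding u P_apply spec_proj_L[OF m] unfolding m_def
    by (rule magnus_FM_intertwined[OF mu_nonneg cont_BP BP r_nonneg])
  have "((\<lambda>N. magnus_coords (BP N) \<mu> l r (P N w)) \<longlongrightarrow> magnus_coords B \<mu> l r w) at_top"
    unfolding magnus_coords_def BP_def
    by (intro bounded_linear.tendsto[OF bounded_linear_scaleC] tendsto_sum
        tendsto_dyson_comp[OF mu_nonneg cont P_le P_lim P_lim r_nonneg])
  then have "((\<lambda>N. norm (magnus_coords (BP N) \<mu> l r (P N w) - magnus_coords B \<mu> l r w)) \<longlongrightarrow> 0) at_top"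
    by (intro tendsto_norm_zero LIM_zero)
  \<comment> \<open>\<open>L r\<close> is an isometry onto the space of order \<open>r\<close>, so
    convergence of coordinates is convergence in the required norm.\<close>
  moreover have "scale_norm D0 H0 r (L r a - L r b) = norm (a - b)" for a b
    using scale_norm_L[OF r_nonneg, of "a - b"]
    by (simp add: linear_diff[OF linear_L[OF r_nonneg]])
  ultimately show ?thesis
    unfolding FM FM_N by (simp add: L_in_scale r_nonneg)
qed

end
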